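(* In the theory of (co)datatypes with default values, every first-order formula can be effectively transformed into an equivalent formula (i.e. one with the same truth value under every valuation in every structure of (co)datatypes with default values) that contains no selectors.
   Context: A (co)datatype signature consists of a set of sorts partitioned into datatypes and codatatypes, and function symbols partitioned into constructors and selectors; there are no predicate symbols. Each (co)datatype $\delta$ has $m \ge 1$ constructors; each constructor $C$ has an arity $\delta_1 \times \cdots \times \delta_n \to \delta$ and comes with selectors $\mathrm{sel}_C^j : \delta \to \delta_j$ ($j=1,\dots,n$). Constructor arguments of datatypes are datatypes, of codatatypes are codatatypes; every datatype has a ground constructor term. Constructor trees of sort $\delta$ are (possibly infinite) rooted ordered trees with root labeled by a constructor $C:\delta_1\times\cdots\times\delta_n\to\delta$ whose children in order are constructor trees of sorts $\delta_1,\dots,\delta_n$. A structure of (co)datatypes interprets codatatypes as all constructor trees of that sort, datatypes as finite constructor trees of that sort, and constructors as tree-building. In the semantics with default values, each selector $\mathrm{sel}_C^i$ has a fixed default value, denoted by a term $T_C^i$ usable in formulas, and is interpreted by $\mathrm{sel}_C^i(C(t_1,\dots,t_n)) = t_i$ and $\mathrm{sel}_C^i(t) = T_C^i$ whenever the root of $t$ is not $C$. *)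

theory Defs
  imports Main "HOL-Library.Nat_Bijection"
begin

section \<open>Signatures\<close>

text \<open>
  Sorts, constructors and variables are named by natural numbers, so that formulas are finite
  objects on which one can compute. A constructor symbol carries its arity
  \<open>\<delta>\<^sub>1 \<times> \<dots> \<times> \<delta>\<^sub>n \<rightarrow> \<delta>\<close>, so a formula mentions the arities of all its symbols; no
  computability or finiteness assumption on the set of sorts is then needed.
\<close>

type_synonym sort = nat

datatype constructor = Constructor (cname: nat) (arg_sorts: "sort list") (res_sort: sort)

record signature =
  data_sorts :: "sort set"
  codata_sorts :: "sort set"
  constructors :: "constructor set"

definition sorts :: "signature \<Rightarrow> sort set" where
  "sorts \<Sigma> = data_sorts \<Sigma> \<union> codata_sorts \<Sigma>"


section \<open>Terms and formulas\<close>

type_synonym var = "nat \<times> sort"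

text \<open>
  \<open>Sel C j t\<close> is the application of the selector of \<open>C\<close> for the argument position \<open>j\<close>, and
  \<open>Dflt C j\<close> is the term denoting the default value of that selector. Positions are counted
  from \<open>0\<close>. The selectors of a signature are thus the pairs \<open>(C, j)\<close> with \<open>j < length (arg_sorts C)\<close>.
\<close>

datatype trm =
    Var var
  | App constructor "trm list"
  | Sel constructor nat trm
  | Dflt constructor nat

datatype fm =
    Tru
  | Fls
  | Eq trm trm
  | Neg fm
  | And fm fm
  | Or fm fm
  | Imp fm fm
  | Iff fm fm
  | All var fm
  | Ex var fm

inductive has_sort :: "signature \<Rightarrow> trm \<Rightarrow> sort \<Rightarrow> bool" for \<Sigma> where
  Var: "\<delta> \<in> sorts \<Sigma> \<Longrightarrow> has_sort \<Sigma> (Var (x, \<delta>)) \<delta>"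
| App: "C \<in> constructors \<Sigma> \<Longrightarrow> list_all2 (has_sort \<Sigma>) ts (arg_sorts C)
    \<Longrightarrow> has_sort \<Sigma> (App C ts) (res_sort C)"
| Sel: "C \<in> constructors \<Sigma> \<Longrightarrow> j < length (arg_sorts C) \<Longrightarrow> has_sort \<Sigma> t (res_sort C)
    \<Longrightarrow> has_sort \<Sigma> (Sel C j t) (arg_sorts C ! j)"
| Dflt: "C \<in> constructors \<Sigma> \<Longrightarrow> j < length (arg_sorts C)
    \<Longrightarrow> has_sort \<Sigma> (Dflt C j) (arg_sorts C ! j)"

primrec formula :: "signature \<Rightarrow> fm \<Rightarrow> bool" where
  "formula \<Sigma> Tru \<longleftrightarrow> True"
| "formula \<Sigma> Fls \<longleftrightarrow> True"
| "formula \<Sigma> (Eq s t) \<longleftrightarrow> (\<exists>\<delta>. has_sort \<Sigma> s \<delta> \<and> has_sort \<Sigma> t \<delta>)"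
| "formula \<Sigma> (Neg \<phi>) \<longleftrightarrow> formula \<Sigma> \<phi>"
| "formula \<Sigma> (And \<phi> \<psi>) \<longleftrightarrow> formula \<Sigma> \<phi> \<and> formula \<Sigma> \<psi>"
| "formula \<Sigma> (Or \<phi> \<psi>) \<longleftrightarrow> formula \<Sigma> \<phi> \<and> formula \<Sigma> \<psi>"
| "formula \<Sigma> (Imp \<phi> \<psi>) \<longleftrightarrow> formula \<Sigma> \<phi> \<and> formula \<Sigma> \<psi>"
| "formula \<Sigma> (Iff \<phi> \<psi>) \<longleftrightarrow> formula \<Sigma> \<phi> \<and> formula \<Sigma> \<psi>"
| "formula \<Sigma> (All v \<phi>) \<longleftrightarrow> snd v \<in> sorts \<Sigma> \<and> formula \<Sigma> \<phi>"
| "formula \<Sigma> (Ex v \<phi>) \<longleftrightarrow> snd v \<in> sorts \<Sigma> \<and> formula \<Sigma> \<phi>"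

primrec ground_constructor_term :: "trm \<Rightarrow> bool" where
  "ground_constructor_term (Var v) \<longleftrightarrow> False"
| "ground_constructor_term (App C ts) \<longleftrightarrow> list_all (\<lambda>b. b) (map ground_constructor_term ts)"
| "ground_constructor_term (Sel C j t) \<longleftrightarrow> False"
| "ground_constructor_term (Dflt C j) \<longleftrightarrow> False"

primrec selector_free_trm :: "trm \<Rightarrow> bool" where
  "selector_free_trm (Var v) \<longleftrightarrow> True"
| "selector_free_trm (App C ts) \<longleftrightarrow> list_all (\<lambda>b. b) (map selector_free_trm ts)"
| "selector_free_trm (Sel C j t) \<longleftrightarrow> False"
| "selector_free_trm (Dflt C j) \<longleftrightarrow> True"

primrec selector_free :: "fm \<Rightarrow> bool" where
  "selector_free Tru \<longleftrightarrow> True"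
| "selector_free Fls \<longleftrightarrow> True"
| "selector_free (Eq s t) \<longleftrightarrow> selector_free_trm s \<and> selector_free_trm t"
| "selector_free (Neg \<phi>) \<longleftrightarrow> selector_free \<phi>"
| "selector_free (And \<phi> \<psi>) \<longleftrightarrow> selector_free \<phi> \<and> selector_free \<psi>"
| "selector_free (Or \<phi> \<psi>) \<longleftrightarrow> selector_free \<phi> \<and> selector_free \<psi>"
| "selector_free (Imp \<phi> \<psi>) \<longleftrightarrow> selector_free \<phi> \<and> selector_free \<psi>"
| "selector_free (Iff \<phi> \<psi>) \<longleftrightarrow> selector_free \<phi> \<and> selector_free \<psi>"
| "selector_free (All v \<phi>) \<longleftrightarrow> selector_free \<phi>"
| "selector_free (Ex v \<phi>) \<longleftrightarrow> selector_free \<phi>"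

definition codt_signature :: "signature \<Rightarrow> bool" where
  "codt_signature \<Sigma> \<longleftrightarrow>
     data_sorts \<Sigma> \<inter> codata_sorts \<Sigma> = {} \<and>
     (\<forall>C\<in>constructors \<Sigma>.
        (res_sort C \<in> data_sorts \<Sigma> \<and> set (arg_sorts C) \<subseteq> data_sorts \<Sigma>) \<or>
        (res_sort C \<in> codata_sorts \<Sigma> \<and> set (arg_sorts C) \<subseteq> codata_sorts \<Sigma>)) \<and>
     (\<forall>\<delta>\<in>sorts \<Sigma>. finite {C \<in> constructors \<Sigma>. res_sort C = \<delta>} \<and>
        {C \<in> constructors \<Sigma>. res_sort C = \<delta>} \<noteq> {}) \<and>
     (\<forall>\<delta>\<in>data_sorts \<Sigma>. \<exists>t. ground_constructor_term t \<and> has_sort \<Sigma> t \<delta>)"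


section \<open>Constructor trees\<close>

codatatype ctree = Node (root: constructor) (children: "ctree list")

coinductive constructor_tree :: "signature \<Rightarrow> sort \<Rightarrow> ctree \<Rightarrow> bool" for \<Sigma> where
  "C \<in> constructors \<Sigma> \<Longrightarrow> list_all2 (constructor_tree \<Sigma>) (arg_sorts C) ts
    \<Longrightarrow> constructor_tree \<Sigma> (res_sort C) (Node C ts)"

inductive finite_tree :: "ctree \<Rightarrow> bool" where
  "(\<And>t. t \<in> set ts \<Longrightarrow> finite_tree t) \<Longrightarrow> finite_tree (Node C ts)"


section \<open>Semantics\<close>

record 'u struct =
  carr :: "sort \<Rightarrow> 'u set"
  con_int :: "constructor \<Rightarrow> 'u list \<Rightarrow> 'u"
  sel_int :: "constructor \<Rightarrow> nat \<Rightarrow> 'u \<Rightarrow> 'u"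
  dflt_int :: "constructor \<Rightarrow> nat \<Rightarrow> 'u"

definition valuation :: "signature \<Rightarrow> 'u struct \<Rightarrow> (var \<Rightarrow> 'u) \<Rightarrow> bool" where
  "valuation \<Sigma> M \<nu> \<longleftrightarrow> (\<forall>x. \<forall>\<delta>\<in>sorts \<Sigma>. \<nu> (x, \<delta>) \<in> carr M \<delta>)"

primrec eval :: "'u struct \<Rightarrow> (var \<Rightarrow> 'u) \<Rightarrow> trm \<Rightarrow> 'u" where
  "eval M \<nu> (Var v) = \<nu> v"
| "eval M \<nu> (App C ts) = con_int M C (map (eval M \<nu>) ts)"
| "eval M \<nu> (Sel C j t) = sel_int M C j (eval M \<nu> t)"
| "eval M \<nu> (Dflt C j) = dflt_int M C j"

primrec sat :: "'u struct \<Rightarrow> (var \<Rightarrow> 'u) \<Rightarrow> fm \<Rightarrow> bool" where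
  "sat M \<nu> Tru \<longleftrightarrow> True"
| "sat M \<nu> Fls \<longleftrightarrow> False"
| "sat M \<nu> (Eq s t) \<longleftrightarrow> eval M \<nu> s = eval M \<nu> t"
| "sat M \<nu> (Neg \<phi>) \<longleftrightarrow> \<not> sat M \<nu> \<phi>"
| "sat M \<nu> (And \<phi> \<psi>) \<longleftrightarrow> sat M \<nu> \<phi> \<and> sat M \<nu> \<psi>"
| "sat M \<nu> (Or \<phi> \<psi>) \<longleftrightarrow> sat M \<nu> \<phi> \<or> sat M \<nu> \<psi>"
| "sat M \<nu> (Imp \<phi> \<psi>) \<longleftrightarrow> (sat M \<nu> \<phi> \<longrightarrow> sat M \<nu> \<psi>)"
| "sat M \<nu> (Iff \<phi> \<psi>) \<longleftrightarrow> (sat M \<nu> \<phi> \<longleftrightarrow> sat M \<nu> \<psi>)"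
| "sat M \<nu> (All v \<phi>) \<longleftrightarrow> (\<forall>a\<in>carr M (snd v). sat M (\<nu>(v := a)) \<phi>)"
| "sat M \<nu> (Ex v \<phi>) \<longleftrightarrow> (\<exists>a\<in>carr M (snd v). sat M (\<nu>(v := a)) \<phi>)"

definition codt_structure :: "signature \<Rightarrow> ctree struct \<Rightarrow> bool" where
  "codt_structure \<Sigma> M \<longleftrightarrow>
     (\<forall>\<delta>\<in>codata_sorts \<Sigma>. carr M \<delta> = {t. constructor_tree \<Sigma> \<delta> t}) \<and>
     (\<forall>\<delta>\<in>data_sorts \<Sigma>. carr M \<delta> = {t. constructor_tree \<Sigma> \<delta> t \<and> finite_tree t}) \<and>
     (\<forall>C\<in>constructors \<Sigma>. \<forall>ts. list_all2 (\<lambda>t \<delta>. t \<in> carr M \<delta>) ts (arg_sorts C)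
        \<longrightarrow> con_int M C ts = Node C ts)"

text \<open>
  The default values are arbitrary elements of the carriers; for a codatatype they may be infinite
  trees, which no constructor term denotes.
\<close>

definition codt_default_structure :: "signature \<Rightarrow> ctree struct \<Rightarrow> bool" where
  "codt_default_structure \<Sigma> M \<longleftrightarrow>
     codt_structure \<Sigma> M \<and>
     (\<forall>C\<in>constructors \<Sigma>. \<forall>j<length (arg_sorts C).
        dflt_int M C j \<in> carr M (arg_sorts C ! j) \<and>
        (\<forall>ts. list_all2 (\<lambda>t \<delta>. t \<in> carr M \<delta>) ts (arg_sorts C)
           \<longrightarrow> sel_int M C j (con_int M C ts) = ts ! j) \<and>
        (\<forall>t\<in>carr M (res_sort C). root t \<noteq> C \<longrightarrow> sel_int M C j t = dflt_int M C j))"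

definition equivalent :: "signature \<Rightarrow> fm \<Rightarrow> fm \<Rightarrow> bool" where
  "equivalent \<Sigma> \<phi> \<psi> \<longleftrightarrow>
     (\<forall>M \<nu>. codt_default_structure \<Sigma> M \<longrightarrow> valuation \<Sigma> M \<nu> \<longrightarrow> (sat M \<nu> \<phi> \<longleftrightarrow> sat M \<nu> \<psi>))"


section \<open>Effective transformations\<close>

text \<open>Kleene's partial recursive functions; \<open>computes r xs y\<close> means that \<open>r\<close> is defined on
  \<open>xs\<close> with value \<open>y\<close>.\<close>

datatype recf =
    Zero
  | Succ
  | Proj nat
  | Comp recf "recf list"
  | PrimRec recf recf
  | Mu recf

inductive computes :: "recf \<Rightarrow> nat list \<Rightarrow> nat \<Rightarrow> bool" where
  Zero: "computes Zero xs 0"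
| Succ: "computes Succ [x] (Suc x)"
| Proj: "i < length xs \<Longrightarrow> computes (Proj i) xs (xs ! i)"
| Comp: "list_all2 (\<lambda>g y. computes g xs y) gs ys \<Longrightarrow> computes f ys z
    \<Longrightarrow> computes (Comp f gs) xs z"
| PrimRec_0: "computes f xs y \<Longrightarrow> computes (PrimRec f g) (0 # xs) y"
| PrimRec_Suc: "computes (PrimRec f g) (n # xs) y \<Longrightarrow> computes g (n # y # xs) z
    \<Longrightarrow> computes (PrimRec f g) (Suc n # xs) z"
| Mu: "computes f (n # xs) 0 \<Longrightarrow> (\<And>m. m < n \<Longrightarrow> \<exists>k. computes f (m # xs) (Suc k))
    \<Longrightarrow> computes (Mu f) xs n"

primrec constructor_code :: "constructor \<Rightarrow> nat" where
  "constructor_code (Constructor c \<delta>s \<delta>) = prod_encode (c, prod_encode (list_encode \<delta>s, \<delta>))"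

primrec trm_code :: "trm \<Rightarrow> nat" where
  "trm_code (Var v) = prod_encode (0, prod_encode v)"
| "trm_code (Dflt C j) = prod_encode (1, prod_encode (constructor_code C, j))"
| "trm_code (App C ts) =
     prod_encode (2, prod_encode (constructor_code C, list_encode (map trm_code ts)))"
| "trm_code (Sel C j t) =
     prod_encode (3, prod_encode (constructor_code C, prod_encode (j, trm_code t)))"

primrec fm_code :: "fm \<Rightarrow> nat" where
  "fm_code Tru = prod_encode (0, 0)"
| "fm_code Fls = prod_encode (1, 0)"
| "fm_code (Eq s t) = prod_encode (2, prod_encode (trm_code s, trm_code t))"
| "fm_code (Neg \<phi>) = prod_encode (3, fm_code \<phi>)"
| "fm_code (And \<phi> \<psi>) = prod_encode (4, prod_encode (fm_code \<phi>, fm_code \<psi>))"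
| "fm_code (Or \<phi> \<psi>) = prod_encode (5, prod_encode (fm_code \<phi>, fm_code \<psi>))"
| "fm_code (Imp \<phi> \<psi>) = prod_encode (6, prod_encode (fm_code \<phi>, fm_code \<psi>))"
| "fm_code (Iff \<phi> \<psi>) = prod_encode (7, prod_encode (fm_code \<phi>, fm_code \<psi>))"
| "fm_code (All v \<phi>) = prod_encode (8, prod_encode (prod_encode v, fm_code \<phi>))"
| "fm_code (Ex v \<phi>) = prod_encode (9, prod_encode (prod_encode v, fm_code \<phi>))"

definition effective :: "(fm \<Rightarrow> fm) \<Rightarrow> bool" where
  "effective F \<longleftrightarrow> (\<exists>r. \<forall>\<phi>. computes r [fm_code \<phi>] (fm_code (F \<phi>)))"

end

theory Submission
  imports Defs
begin

text \<open>
  An equation \<open>s = t\<close> is flattened: every subterm \<open>u\<close> gets a fresh variable \<open>x\<^sub>u\<close>, and the equation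
  becomes the existence of values for the \<open>x\<^sub>u\<close> that satisfy the defining equations of the subterms
  and \<open>x\<^sub>s = x\<^sub>t\<close>. The defining equation of a selector application \<open>u = sel\<^sub>C\<^sup>j w\<close> is expressed
  without selectors as
  \<open>(\<exists>y\<^sub>1 \<dots> y\<^sub>n. x\<^sub>w = C y\<^sub>1 \<dots> y\<^sub>n \<and> x\<^sub>u = y\<^sub>j) \<or> (\<not> (\<exists>y\<^sub>1 \<dots> y\<^sub>n. x\<^sub>w = C y\<^sub>1 \<dots> y\<^sub>n) \<and> x\<^sub>u = T\<^sub>C\<^sup>j)\<close>,
  which mentions only the sorts carried by \<open>C\<close>, so one transformation serves all signatures. It is a
  structural recursion, hence a course-of-values recursion on codes.
\<close>

section \<open>Recursive functions on pairs and lists\<close>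

definition recn :: "nat \<Rightarrow> (nat list \<Rightarrow> nat) \<Rightarrow> bool" where
  "recn n f \<longleftrightarrow> (\<exists>r. \<forall>xs. length xs = n \<longrightarrow> computes r xs (f xs))"

definition rec1 :: "(nat \<Rightarrow> nat) \<Rightarrow> bool" where
  "rec1 f \<longleftrightarrow> recn 1 (\<lambda>xs. f (xs ! 0))"

definition rec2 :: "(nat \<Rightarrow> nat \<Rightarrow> nat) \<Rightarrow> bool" where
  "rec2 f \<longleftrightarrow> recn 2 (\<lambda>xs. f (xs ! 0) (xs ! 1))"

lemma recn_nth: "i < n \<Longrightarrow> recn n (\<lambda>xs. xs ! i)"
  unfolding recn_def by (rule exI[of _ "Proj i"]) (auto intro: computes.Proj)

lemma recn_comp1:
  assumes "rec1 f" "recn n g" shows "recn n (\<lambda>xs. f (g xs))"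
proof -
  obtain r s where r: "\<forall>xs. length xs = 1 \<longrightarrow> computes r xs (f (xs ! 0))"
    and s: "\<forall>xs. length xs = n \<longrightarrow> computes s xs (g xs)"
    using assms unfolding rec1_def recn_def by blast
  have "computes (Comp r [s]) xs (f (g xs))" if "length xs = n" for xs
    using r[rule_format, of "[g xs]"] s that by (auto intro!: computes.Comp[of _ _ "[g xs]"])
  then show ?thesis unfolding recn_def by blast
qed

lemma recn_comp2:
  assumes "rec2 f" "recn n g" "recn n h" shows "recn n (\<lambda>xs. f (g xs) (h xs))"
proof -
  obtain r s t where r: "\<forall>xs. length xs = 2 \<longrightarrow> computes r xs (f (xs ! 0) (xs ! 1))"
    and s: "\<forall>xs. length xs = n \<longrightarrow> computes s xs (g xs)"
    and t: "\<forall>xs. length xs = n \<longrightarrow> computes t xs (h xs)"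
    using assms unfolding rec2_def recn_def by blast
  have "computes (Comp r [s, t]) xs (f (g xs) (h xs))" if "length xs = n" for xs
    using r[rule_format, of "[g xs, h xs]"] s t that
    by (auto intro!: computes.Comp[of _ _ "[g xs, h xs]"])
  then show ?thesis unfolding recn_def by blast
qed

lemma recn_0: "recn n (\<lambda>_. 0)"
  unfolding recn_def by (auto intro: computes.Zero)

lemma rec1_Suc: "rec1 Suc"
  unfolding rec1_def recn_def
  by (rule exI[of _ Succ]) (auto simp: length_Suc_conv intro: computes.Succ)

lemma recn_const: "recn n (\<lambda>_. c)"
  by (induction c) (auto intro: recn_0 recn_comp1[OF rec1_Suc])

text \<open>One parameter is enough, since several can be packed into one by pairing. The step takes
  counter, previous value and parameter in the order fixed by \<open>PrimRec\<close>.\<close>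

lemma recn_primrec:
  assumes "rec1 f" "recn 3 (\<lambda>xs. g (xs ! 0) (xs ! 1) (xs ! 2))"
  shows "rec2 (\<lambda>n x. rec_nat (f x) (\<lambda>k y. g k y x) n)"
proof -
  obtain r s where r: "\<forall>xs. length xs = 1 \<longrightarrow> computes r xs (f (xs ! 0))"
    and s: "\<forall>xs. length xs = 3 \<longrightarrow> computes s xs (g (xs ! 0) (xs ! 1) (xs ! 2))"
    using assms unfolding rec1_def recn_def by blast
  have "computes (PrimRec r s) [n, x] (rec_nat (f x) (\<lambda>k y. g k y x) n)" for n x
  proof (induction n)
    case 0
    then show ?case using r[rule_format, of "[x]"] by (auto intro: computes.PrimRec_0)
  next
    case (Suc n)
    then show ?case using s[rule_format, of "[n, rec_nat (f x) (\<lambda>k y. g k y x) n, x]"]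
      by (auto intro: computes.PrimRec_Suc)
  qed
  then show ?thesis unfolding rec2_def recn_def
    by (intro exI[of _ "PrimRec r s"]) (auto simp: length_Suc_conv numeral_2_eq_2)
qed

text \<open>Existence of a zero makes the search total, and minimality gives the nonzero values
  below it that the rule for \<open>Mu\<close> demands.\<close>

lemma rec1_mu:
  assumes "rec2 f" "\<And>x. \<exists>k. f k x = 0"
  shows "rec1 (\<lambda>x. LEAST k. f k x = 0)"
proof -
  obtain r where r: "\<forall>xs. length xs = 2 \<longrightarrow> computes r xs (f (xs ! 0) (xs ! 1))"
    using assms(1) unfolding rec2_def recn_def by blast
  have "computes (Mu r) [x] (LEAST k. f k x = 0)" for x
  proof (rule computes.Mu)
    show "computes r [LEAST k. f k x = 0, x] 0"
      using r[rule_format, of "[LEAST k. f k x = 0, x]"] LeastI_ex[OF assms(2), of x] by simp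
    show "\<exists>k. computes r [m, x] (Suc k)" if "m < (LEAST k. f k x = 0)" for m
      using r[rule_format, of "[m, x]"] not_less_Least[OF that] by (cases "f m x") auto
  qed
  then show ?thesis unfolding rec1_def recn_def
    by (intro exI[of _ "Mu r"]) (auto simp: length_Suc_conv)
qed

lemma rec1_id: "rec1 (\<lambda>x. x)"
  unfolding rec1_def by (rule recn_nth) simp

lemma rec1_const: "rec1 (\<lambda>_. c)"
  unfolding rec1_def by (rule recn_const)

lemma rec1_comp1: "rec1 f \<Longrightarrow> rec1 g \<Longrightarrow> rec1 (\<lambda>x. f (g x))"
  unfolding rec1_def[of g] rec1_def[of "\<lambda>x. f (g x)"] by (rule recn_comp1)

lemma rec1_comp2: "rec2 f \<Longrightarrow> rec1 g \<Longrightarrow> rec1 h \<Longrightarrow> rec1 (\<lambda>x. f (g x) (h x))"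
  unfolding rec1_def by (rule recn_comp2)

lemma rec2_comp1: "rec1 f \<Longrightarrow> rec2 g \<Longrightarrow> rec2 (\<lambda>x y. f (g x y))"
  unfolding rec2_def by (rule recn_comp1)

lemma rec2_comp2: "rec2 f \<Longrightarrow> rec2 g \<Longrightarrow> rec2 h \<Longrightarrow> rec2 (\<lambda>x y. f (g x y) (h x y))"
  unfolding rec2_def[of g] rec2_def[of h] rec2_def[of "\<lambda>x y. f (g x y) (h x y)"]
  by (rule recn_comp2)

lemma rec2_fst: "rec2 (\<lambda>x y. x)" and rec2_snd: "rec2 (\<lambda>x y. y)"
  unfolding rec2_def by (rule recn_nth, simp)+

lemma rec2_add: "rec2 (+)"
proof -
  have "rec2 (\<lambda>n x. rec_nat x (\<lambda>k y. Suc y) n)"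
    by (rule recn_primrec) (auto intro!: rec1_id recn_comp1[OF rec1_Suc] recn_nth)
  moreover have "rec_nat x (\<lambda>k y. Suc y) n = n + x" for n x by (induction n) auto
  ultimately show ?thesis by simp
qed

lemma rec1_pred: "rec1 (\<lambda>x. x - 1)"
proof -
  have "rec2 (\<lambda>n x. rec_nat 0 (\<lambda>k y. k) n)"
    by (rule recn_primrec[where f = "\<lambda>_. 0"]) (auto intro!: rec1_const recn_nth)
  \<comment> \<open>The parameter is a dummy; substituting \<open>n\<close> for it as well yields a
    one-place function.\<close>
  from rec1_comp2[OF this rec1_id rec1_id]
  have "rec1 (\<lambda>n. rec_nat 0 (\<lambda>k y. k) n)" .
  moreover have "rec_nat 0 (\<lambda>k y. k) n = n - 1" for n :: nat by (cases n) auto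
  ultimately show ?thesis by simp
qed

lemma rec2_diff: "rec2 (-)"
proof -
  have "rec2 (\<lambda>n x. rec_nat x (\<lambda>k y. y - 1) n)"
    by (rule recn_primrec) (auto intro!: rec1_id recn_comp1[OF rec1_pred[simplified]] recn_nth)
  moreover have "rec_nat x (\<lambda>k y. y - 1) n = x - n" for n x :: nat by (induction n) auto
  ultimately have "rec2 (\<lambda>n x. x - n)" by simp
  \<comment> \<open>The recursion ran over the subtrahend, as first argument, so the arguments are
    swapped back.\<close>
  from rec2_comp2[OF this rec2_snd rec2_fst] show ?thesis by simp
qed

lemma rec1_triangle: "rec1 triangle"
proof -
  have "rec2 (\<lambda>n x. rec_nat 0 (\<lambda>k y. y + Suc k) n)"
    by (rule recn_primrec[where f = "\<lambda>_. 0"])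
      (intro rec1_const recn_comp2[OF rec2_add] recn_comp1[OF rec1_Suc] recn_nth; simp)+
  from rec1_comp2[OF this rec1_id rec1_id]
  have "rec1 (\<lambda>n. rec_nat 0 (\<lambda>k y. y + Suc k) n)" .
  moreover have "rec_nat 0 (\<lambda>k y. y + Suc k) n = triangle n" for n by (induction n) auto
  ultimately show ?thesis by simp
qed

section \<open>Cantor pairing and its projections\<close>

definition pair :: "nat \<Rightarrow> nat \<Rightarrow> nat" where "pair a b = prod_encode (a, b)"
definition pfst :: "nat \<Rightarrow> nat" where "pfst p = fst (prod_decode p)"
definition psnd :: "nat \<Rightarrow> nat" where "psnd p = snd (prod_decode p)"

lemma pfst_pair [simp]: "pfst (pair a b) = a" and psnd_pair [simp]: "psnd (pair a b) = b"
  by (simp_all add: pair_def pfst_def psnd_def)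

lemma pair_pfst_psnd [simp]: "pair (pfst p) (psnd p) = p"
  by (simp add: pair_def pfst_def psnd_def)

text \<open>As \<open>0\<close> codes the empty list, these make its head and its tail
  \<open>0\<close> again: running off the end of a coded list is harmless.\<close>

lemma pfst_0 [simp]: "pfst 0 = 0" and psnd_0 [simp]: "psnd 0 = 0"
  by (simp_all add: pfst_def psnd_def prod_decode_def prod_decode_aux.simps)

lemma le_pair: "a \<le> pair a b" "b \<le> pair a b"
  by (simp_all add: pair_def le_prod_encode_1 le_prod_encode_2)

text \<open>Raising the first component strictly raises the pair. A positive tag thus makes a code
  larger than its payload, which is what lets recursion on codes descend.\<close>

lemma less_pair: "0 < a \<Longrightarrow> b < pair a b"
  using le_prod_encode_2[of b "a - 1"]
  by (cases a) (auto simp: pair_def prod_encode_def)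

lemma rec2_pair: "rec2 pair"
proof -
  have "rec2 (\<lambda>a b. triangle (a + b) + a)"
    by (intro rec2_comp2[OF rec2_add] rec2_comp1[OF rec1_triangle] rec2_fst rec2_add)
  moreover have "pair = (\<lambda>a b. triangle (a + b) + a)"
    by (intro ext) (simp add: pair_def prod_encode_def)
  ultimately show ?thesis by simp
qed

lemma triangle_mono: "m \<le> n \<Longrightarrow> triangle m \<le> triangle n"
  by (induction n) (auto simp: le_Suc_eq)

text \<open>The antidiagonal on which the pair coded by \<open>p\<close> lies is the least \<open>k\<close> with
  \<open>p < triangle (Suc k)\<close>.\<close>

lemma pfst_plus_psnd: "pfst p + psnd p = (LEAST k. Suc p - triangle (Suc k) = 0)"
proof (rule sym, rule Least_equality)
  have p: "p = triangle (pfst p + psnd p) + pfst p"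
    using pair_pfst_psnd[of p] by (simp add: pair_def prod_encode_def)
  then show "Suc p - triangle (Suc (pfst p + psnd p)) = 0" by simp
  show "pfst p + psnd p \<le> k" if "Suc p - triangle (Suc k) = 0" for k
  proof (rule ccontr)
    assume "\<not> pfst p + psnd p \<le> k"
    then have "triangle (Suc k) \<le> triangle (pfst p + psnd p)" by (intro triangle_mono) simp
    with that p show False by simp
  qed
qed

text \<open>Minimisation finds the antidiagonal; the first component is the offset of
  \<open>p\<close> from the triangular number there, and the second is the rest of the sum.\<close>

lemma rec1_pfst: "rec1 pfst" and rec1_psnd: "rec1 psnd"
proof -
  let ?d = "\<lambda>p. pfst p + psnd p"
  have "rec2 (\<lambda>k p. Suc p - triangle (Suc k))"
    by (intro rec2_comp2[OF rec2_diff] rec2_comp1[OF rec1_triangle] rec2_comp1[OF rec1_Suc]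
        rec2_fst rec2_snd)
  moreover have "\<exists>k. Suc p - triangle (Suc k) = 0" for p
    by (rule exI[of _ p]) simp
  ultimately have d: "rec1 ?d" unfolding pfst_plus_psnd by (rule rec1_mu)
  have f: "pfst p = p - triangle (?d p)" for p
    using pair_pfst_psnd[of p] unfolding pair_def prod_encode_def by simp
  have "rec1 (\<lambda>p. p - triangle (?d p))"
    by (intro rec1_comp2[OF rec2_diff] rec1_comp1[OF rec1_triangle] rec1_id d)
  then show "rec1 pfst" by (simp flip: f)
  then have "rec1 (\<lambda>p. ?d p - pfst p)"
    by (intro rec1_comp2[OF rec2_diff] d)
  then show "rec1 psnd" by simp
qed

lemmas rec1_intros = rec1_id rec1_const rec1_comp1[OF rec1_Suc] rec1_comp1[OF rec1_pfst]
  rec1_comp1[OF rec1_psnd] rec1_comp2[OF rec2_add] rec1_comp2[OF rec2_diff]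
  rec1_comp2[OF rec2_pair]

text \<open>The step is uncurried: \<open>q\<close> codes the parameter, the counter and the
  previous value as nested pairs. From here on one-place functions suffice.\<close>

lemma rec1_rec_nat:
  assumes b: "rec1 b" and s: "rec1 (\<lambda>q. s (pfst q) (pfst (psnd q)) (psnd (psnd q)))" and m: "rec1 m"
  shows "rec1 (\<lambda>x. rec_nat (b x) (s x) (m x))"
proof -
  have "recn 3 (\<lambda>xs. (\<lambda>q. s (pfst q) (pfst (psnd q)) (psnd (psnd q)))
      (pair (xs ! 2) (pair (xs ! 0) (xs ! 1))))"
    by (intro recn_comp1[OF s] recn_comp2[OF rec2_pair] recn_nth) simp_all
  then have "rec2 (\<lambda>n x. rec_nat (b x) (\<lambda>k y. s x k y) n)"
    by (intro recn_primrec[OF b]) simp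
  from rec1_comp2[OF this m rec1_id] show ?thesis .
qed

text \<open>Recursion over the distance of \<open>f x\<close> and \<open>g x\<close>: stage zero
  returns \<open>h x\<close>, every later stage \<open>k x\<close>.\<close>

lemma rec1_if:
  assumes "rec1 f" "rec1 g" "rec1 h" "rec1 k"
  shows "rec1 (\<lambda>x. if f x = g x then h x else k x)"
proof -
  have "rec1 (\<lambda>x. rec_nat (h x) (\<lambda>_ _. k x) (f x - g x + (g x - f x)))"
    by (intro rec1_rec_nat rec1_intros assms rec1_comp1[OF assms(4)])
  moreover have "rec_nat (h x) (\<lambda>_ _. k x) (f x - g x + (g x - f x))
      = (if f x = g x then h x else k x)" for x
    by (cases "f x - g x + (g x - f x)") auto
  ultimately show ?thesis by simp
qed

section \<open>Coded lists and course-of-values recursion\<close>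

definition ldrop :: "nat \<Rightarrow> nat \<Rightarrow> nat" where
  "ldrop j l = rec_nat l (\<lambda>_ r. psnd (r - 1)) j"

definition lhd :: "nat \<Rightarrow> nat" where
  "lhd l = pfst (l - 1)"

definition lcons :: "nat \<Rightarrow> nat \<Rightarrow> nat" where
  "lcons x l = Suc (pair x l)"

text \<open>\<open>l - 1\<close> undoes the \<open>Suc\<close> that \<open>list_encode\<close> puts
  around the pair of head and tail, so \<open>psnd (l - 1)\<close> is the tail. The recursion adds
  tail steps on the outside; moving one inside fits induction on the list.\<close>

lemma ldrop_0: "ldrop 0 l = l" and ldrop_Suc: "ldrop (Suc j) l = ldrop j (psnd (l - 1))"
  unfolding ldrop_def by (simp, induction j, auto)

lemma lhd_lcons [simp]: "lhd (lcons x l) = x"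
  by (simp add: lhd_def lcons_def)

lemma ldrop_lcons [simp]: "ldrop (Suc j) (lcons x l) = ldrop j l"
  by (simp add: ldrop_Suc lcons_def)

lemma ldrop_list_encode: "ldrop j (list_encode xs) = list_encode (drop j xs)"
proof (induction xs arbitrary: j)
  case Nil
  have "ldrop j 0 = 0" by (induction j) (auto simp: ldrop_0 ldrop_Suc)
  then show ?case by simp
next
  case (Cons x xs)
  then show ?case by (cases j) (auto simp: ldrop_0 ldrop_Suc psnd_def)
qed

text \<open>
  At stage \<open>n\<close> of a course-of-values recursion, the history is the code of the
  list \<open>[f (n - 1), \<dots>, f 0]\<close>, so the value at \<open>k < n\<close> sits at position \<open>n - Suc k\<close>.
\<close>

definition hist :: "(nat \<Rightarrow> nat \<Rightarrow> nat) \<Rightarrow> nat \<Rightarrow> nat" where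
  "hist G n = rec_nat 0 (\<lambda>k h. lcons (G k h) h) n"

definition cov :: "(nat \<Rightarrow> nat \<Rightarrow> nat) \<Rightarrow> nat \<Rightarrow> nat" where
  "cov G n = G n (hist G n)"

definition look :: "nat \<Rightarrow> nat \<Rightarrow> nat \<Rightarrow> nat" where
  "look h n k = lhd (ldrop (n - Suc k) h)"

text \<open>Induction on the stage: the newest value is the head, and each stage pushes the older
  ones back by one position.\<close>

lemma look_hist:
  assumes "k < n" shows "look (hist G n) n k = cov G k"
  using assms
proof (induction n)
  case (Suc n)
  show ?case
  proof (cases "k = n")
    case True
    then show ?thesis by (simp add: look_def hist_def cov_def ldrop_0)
  next
    case False
    with Suc have "k < n" by simp
    then have "Suc n - Suc k = Suc (n - Suc k)" by simp
    with Suc \<open>k < n\<close> show ?thesis by (simp add: look_def hist_def)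
  qed
qed simp

lemmas rec1_nat_intros = rec1_intros rec1_if rec1_rec_nat

lemma rec1_cov:
  assumes G: "rec1 (\<lambda>q. G (pfst q) (pfst (psnd q)) (psnd (psnd q)))" and m: "rec1 m"
  shows "rec1 (\<lambda>x. cov (G x) (m x))"
proof -
  \<comment> \<open>Recursiveness of the uncurried \<open>G\<close> becomes a closure rule for
    arbitrary recursive arguments.\<close>
  have G': "rec1 (\<lambda>x. G (a x) (b x) (c x))" if "rec1 a" "rec1 b" "rec1 c" for a b c
    using rec1_comp1[OF G, of "\<lambda>x. pair (a x) (pair (b x) (c x))"] that
    by (simp add: rec1_intros)
  show ?thesis unfolding cov_def hist_def lcons_def
    by (intro G' rec1_nat_intros m rec1_comp1[OF m])
qed

lemma rec1_lhd: "rec1 f \<Longrightarrow> rec1 (\<lambda>x. lhd (f x))"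
  unfolding lhd_def by (intro rec1_intros)

lemma rec1_ldrop: "rec1 f \<Longrightarrow> rec1 g \<Longrightarrow> rec1 (\<lambda>x. ldrop (f x) (g x))"
  unfolding ldrop_def by (intro rec1_nat_intros)

lemma rec1_lcons: "rec1 f \<Longrightarrow> rec1 g \<Longrightarrow> rec1 (\<lambda>x. lcons (f x) (g x))"
  unfolding lcons_def by (intro rec1_nat_intros)

lemma rec1_look: "rec1 f \<Longrightarrow> rec1 g \<Longrightarrow> rec1 h \<Longrightarrow> rec1 (\<lambda>x. look (f x) (g x) (h x))"
  unfolding look_def by (intro rec1_intros rec1_lhd rec1_ldrop)

text \<open>A right fold over a coded list, by course-of-values recursion on the code because a tail
  has a smaller code. The step sees the whole remaining list and not only its head, since
  \<open>carg_vars\<close> names variables after suffixes.\<close>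

definition lrec :: "nat \<Rightarrow> (nat \<Rightarrow> nat \<Rightarrow> nat) \<Rightarrow> nat \<Rightarrow> nat" where
  "lrec b s = cov (\<lambda>l h. if l = 0 then b else s l (look h l (psnd (l - 1))))"

lemma lrec_Nil [simp]: "lrec b s 0 = b"
  by (simp add: lrec_def cov_def)

lemma lrec_Cons [simp]: "lrec b s (list_encode (x # xs)) = s (list_encode (x # xs)) (lrec b s (list_encode xs))"
proof -
  have "psnd (prod_encode (x, list_encode xs)) = list_encode xs" by (simp add: psnd_def)
  moreover have "list_encode xs < Suc (prod_encode (x, list_encode xs))"
    by (simp add: le_prod_encode_2 less_Suc_eq_le)
  ultimately show ?thesis
    unfolding lrec_def cov_def[of _ "list_encode (x # xs)"] by (simp add: look_hist)
qed

lemma rec1_lrec: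
  assumes "rec1 b" and s: "rec1 (\<lambda>q. s (pfst q) (pfst (psnd q)) (psnd (psnd q)))" and "rec1 l"
  shows "rec1 (\<lambda>x. lrec (b x) (s x) (l x))"
proof -
  have s': "rec1 (\<lambda>x. s (a x) (b x) (c x))" if "rec1 a" "rec1 b" "rec1 c" for a b c
    using rec1_comp1[OF s, of "\<lambda>x. pair (a x) (pair (b x) (c x))"] that
    by (simp add: rec1_intros)
  show ?thesis unfolding lrec_def
    by (intro rec1_cov rec1_intros rec1_if s' rec1_look assms rec1_comp1[OF assms(1)])
qed


section \<open>Elimination of selectors\<close>

text \<open>The value \<open>0\<close> on the empty list agrees with \<open>lhd\<close> on codes, so
  that \<open>sort_of\<close> is computed correctly even for selectors with a position out of
  range.\<close>

definition lhd0 :: "nat list \<Rightarrow> nat" where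
  "lhd0 xs = (case xs of [] \<Rightarrow> 0 | x # _ \<Rightarrow> x)"

primrec sort_of :: "trm \<Rightarrow> sort" where
  "sort_of (Var v) = snd v"
| "sort_of (App C ts) = res_sort C"
| "sort_of (Sel C j t) = lhd0 (drop j (arg_sorts C))"
| "sort_of (Dflt C j) = lhd0 (drop j (arg_sorts C))"

text \<open>
  Fresh variables are named by codes: the variable of a term by the code of the term, the variable of
  a constructor argument by the code of the list of sorts starting at that argument. The offset \<open>N\<close>
  exceeds all variables of the equation at hand, and parity separates the two kinds. Since the
  name of \<open>x\<^sub>u\<close> determines \<open>u\<close>, repeated subterms may share a variable.
\<close>

definition trm_var :: "nat \<Rightarrow> trm \<Rightarrow> var" where
  "trm_var N t = (N + (trm_code t + trm_code t), sort_of t)"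

definition arg_var :: "nat \<Rightarrow> sort list \<Rightarrow> var" where
  "arg_var N \<delta>s = (Suc (N + (list_encode \<delta>s + list_encode \<delta>s)), lhd0 \<delta>s)"

primrec arg_vars :: "nat \<Rightarrow> sort list \<Rightarrow> var list" where
  "arg_vars N [] = []"
| "arg_vars N (\<delta> # \<delta>s) = arg_var N (\<delta> # \<delta>s) # arg_vars N \<delta>s"

definition Exs :: "var list \<Rightarrow> fm \<Rightarrow> fm" where
  "Exs vs \<phi> = foldr Ex vs \<phi>"

definition Conj :: "fm list \<Rightarrow> fm" where
  "Conj \<phi>s = foldr And \<phi>s Tru"

definition sel_graph :: "nat \<Rightarrow> constructor \<Rightarrow> nat \<Rightarrow> var \<Rightarrow> var \<Rightarrow> fm" where
  "sel_graph N C j z v =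
     (let ys = arg_vars N (arg_sorts C); e = Eq (Var z) (App C (map Var ys)) in
      Or (Exs ys (And e (Eq (Var v) (Var (arg_var N (drop j (arg_sorts C)))))))
         (And (Neg (Exs ys e)) (Eq (Var v) (Dflt C j))))"

text \<open>Intended meaning: the variable \<open>trm_var N t\<close> holds the value of
  \<open>t\<close>. Each level binds the variables of the immediate arguments and leaves its own
  free.\<close>

primrec trm_graph :: "nat \<Rightarrow> trm \<Rightarrow> fm" where
  "trm_graph N (Var u) = Eq (Var (trm_var N (Var u))) (Var u)"
| "trm_graph N (App C ts) =
     Exs (map (trm_var N) ts) (And (Conj (map (trm_graph N) ts))
       (Eq (Var (trm_var N (App C ts))) (App C (map Var (map (trm_var N) ts)))))"
| "trm_graph N (Sel C j t) =
     Ex (trm_var N t) (And (trm_graph N t)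
       (sel_graph N C j (trm_var N t) (trm_var N (Sel C j t))))"
| "trm_graph N (Dflt C j) = Eq (Var (trm_var N (Dflt C j))) (Dflt C j)"

text \<open>A variable index is bounded by the code of any term containing it, so the successor of
  the sum of both codes is a computable fresh offset. The new variables are bound right around the
  equation, hence quantifiers and connectives stay as they are.\<close>

primrec elim_sel :: "fm \<Rightarrow> fm" where
  "elim_sel Tru = Tru"
| "elim_sel Fls = Fls"
| "elim_sel (Eq s t) = (let N = Suc (trm_code s + trm_code t) in
     Exs [trm_var N s, trm_var N t] (And (trm_graph N s) (And (trm_graph N t)
       (Eq (Var (trm_var N s)) (Var (trm_var N t))))))"
| "elim_sel (Neg \<phi>) = Neg (elim_sel \<phi>)"
| "elim_sel (And \<phi> \<psi>) = And (elim_sel \<phi>) (elim_sel \<psi>)"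
| "elim_sel (Or \<phi> \<psi>) = Or (elim_sel \<phi>) (elim_sel \<psi>)"
| "elim_sel (Imp \<phi> \<psi>) = Imp (elim_sel \<phi>) (elim_sel \<psi>)"
| "elim_sel (Iff \<phi> \<psi>) = Iff (elim_sel \<phi>) (elim_sel \<psi>)"
| "elim_sel (All v \<phi>) = All v (elim_sel \<phi>)"
| "elim_sel (Ex v \<phi>) = Ex v (elim_sel \<phi>)"

section \<open>Selector-freeness and blocks of quantifiers\<close>

lemma selector_free_Exs [simp]: "selector_free (Exs vs \<phi>) = selector_free \<phi>"
  unfolding Exs_def by (induction vs) auto

lemma selector_free_Conj [simp]: "selector_free (Conj \<phi>s) = list_all selector_free \<phi>s"
  unfolding Conj_def by (induction \<phi>s) auto

lemma selector_free_trm_graph: "selector_free (trm_graph N t)"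
  by (induction t) (auto simp: list_all_iff sel_graph_def Let_def)

lemma selector_free_elim_sel: "selector_free (elim_sel \<phi>)"
  by (induction \<phi>) (auto simp: selector_free_trm_graph Let_def)

lemma formula_Exs [simp]: "formula \<Sigma> (Exs vs \<phi>) \<longleftrightarrow> snd ` set vs \<subseteq> sorts \<Sigma> \<and> formula \<Sigma> \<phi>"
  unfolding Exs_def by (induction vs) auto

lemma formula_Conj [simp]: "formula \<Sigma> (Conj \<phi>s) \<longleftrightarrow> list_all (formula \<Sigma>) \<phi>s"
  unfolding Conj_def by (induction \<phi>s) auto

lemma sat_Conj [simp]: "sat M \<nu> (Conj \<phi>s) \<longleftrightarrow> list_all (sat M \<nu>) \<phi>s"
  unfolding Conj_def by (induction \<phi>s) auto

text \<open>The successive updates collapse into one valuation. Repetitions in \<open>vs\<close> are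
  allowed, because the innermost update wins.\<close>

lemma sat_Exs: "sat M \<nu> (Exs vs \<phi>) \<longleftrightarrow> (\<exists>\<nu>'. (\<forall>v. v \<notin> set vs \<longrightarrow> \<nu>' v = \<nu> v) \<and>
    (\<forall>v\<in>set vs. \<nu>' v \<in> carr M (snd v)) \<and> sat M \<nu>' \<phi>)"
proof (induction vs arbitrary: \<nu>)
  case Nil
  have "\<nu>' = \<nu>" if "\<forall>v. \<nu>' v = \<nu> v" for \<nu>' using that by blast
  then show ?case by (auto simp: Exs_def)
next
  case (Cons v vs)
  have "sat M \<nu> (Exs (v # vs) \<phi>) \<longleftrightarrow> (\<exists>a\<in>carr M (snd v). sat M (\<nu>(v := a)) (Exs vs \<phi>))"
    by (simp add: Exs_def)
  also have "\<dots> \<longleftrightarrow> (\<exists>a\<in>carr M (snd v). \<exists>\<nu>'. (\<forall>u. u \<notin> set vs \<longrightarrow> \<nu>' u = (\<nu>(v := a)) u) \<and>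
    (\<forall>u\<in>set vs. \<nu>' u \<in> carr M (snd u)) \<and> sat M \<nu>' \<phi>)"
    by (simp add: Cons.IH)
  also have "\<dots> \<longleftrightarrow> (\<exists>\<nu>'. (\<forall>u. u \<notin> set (v # vs) \<longrightarrow> \<nu>' u = \<nu> u) \<and>
    (\<forall>u\<in>set (v # vs). \<nu>' u \<in> carr M (snd u)) \<and> sat M \<nu>' \<phi>)" (is "?L \<longleftrightarrow> ?R")
  proof
    assume ?L
    then obtain a \<nu>' where h: "a \<in> carr M (snd v)" "\<forall>u. u \<notin> set vs \<longrightarrow> \<nu>' u = (\<nu>(v := a)) u"
      "\<forall>u\<in>set vs. \<nu>' u \<in> carr M (snd u)" "sat M \<nu>' \<phi>" by blast
    \<comment> \<open>If \<open>v\<close> recurs in \<open>vs\<close>, the value \<open>a\<close> is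
      overwritten and membership comes from the inner block; otherwise it comes from
      \<open>a\<close>.\<close>
    then have "\<nu>' v \<in> carr M (snd v)" by (cases "v \<in> set vs") (blast, metis fun_upd_same)
    with h show ?R by (intro exI[of _ \<nu>']) auto
  next
    assume ?R
    then obtain \<nu>' where h: "\<forall>u. u \<notin> set (v # vs) \<longrightarrow> \<nu>' u = \<nu> u"
      "\<forall>u\<in>set (v # vs). \<nu>' u \<in> carr M (snd u)" "sat M \<nu>' \<phi>" by blast
    then show ?L by (intro bexI[of _ "\<nu>' v"] exI[of _ \<nu>']) auto
  qed
  finally show ?case .
qed

lemma valuation_cong:
  assumes "valuation \<Sigma> M \<nu>" "\<forall>v. v \<notin> V \<longrightarrow> \<nu>' v = \<nu> v" "\<forall>v\<in>V. \<nu>' v \<in> carr M (snd v)"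
  shows "valuation \<Sigma> M \<nu>'"
  unfolding valuation_def
proof (intro allI ballI)
  fix x \<delta> assume "\<delta> \<in> sorts \<Sigma>"
  then show "\<nu>' (x, \<delta>) \<in> carr M \<delta>"
    using assms unfolding valuation_def by (cases "(x, \<delta>) \<in> V") force+
qed

lemma valuation_upd: "valuation \<Sigma> M \<nu> \<Longrightarrow> a \<in> carr M (snd v) \<Longrightarrow> valuation \<Sigma> M (\<nu>(v := a))"
  by (rule valuation_cong[where V = "{v}"]) auto

section \<open>Codes and freshness of the new variables\<close>

lemma constructor_code_inj [simp]: "constructor_code C = constructor_code D \<longleftrightarrow> C = D"
  by (cases C; cases D) (auto simp: prod_encode_eq list_encode_eq)

lemma trm_code_inj: "trm_code s = trm_code t \<Longrightarrow> s = t"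
proof (induction s arbitrary: t)
  case (App C ts)
  then obtain us where t: "t = App C us" and eq: "map trm_code ts = map trm_code us"
    by (cases t) (auto simp: prod_encode_eq list_encode_eq)
  from eq App.IH have "ts = us"
    by (intro nth_equalityI) (metis length_map, metis length_map nth_map nth_mem)
  with t show ?case by simp
next
  case (Var v) then show ?case by (cases t) (auto simp: prod_encode_eq)
next
  case (Sel C j s) then show ?case by (cases t) (auto simp: prod_encode_eq)
next
  case (Dflt C j) then show ?case by (cases t) (auto simp: prod_encode_eq)
qed

lemma trm_var_inj [simp]: "trm_var N s = trm_var N t \<longleftrightarrow> s = t"
  by (auto simp: trm_var_def intro: trm_code_inj)

lemma trm_var_eq_arg_var [simp]: "trm_var N s \<noteq> arg_var N \<delta>s" "arg_var N \<delta>s \<noteq> trm_var N s"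
  by (auto simp: trm_var_def arg_var_def) presburger+

lemma fst_trm_var: "N \<le> fst (trm_var N t)"
  by (simp add: trm_var_def)

lemma arg_var_inj [simp]: "arg_var N \<delta>s = arg_var N \<epsilon>s \<longleftrightarrow> \<delta>s = \<epsilon>s"
proof
  assume "arg_var N \<delta>s = arg_var N \<epsilon>s"
  then have "list_encode \<delta>s = list_encode \<epsilon>s" by (simp add: arg_var_def)
  then show "\<delta>s = \<epsilon>s" by (simp add: list_encode_eq)
qed simp

text \<open>The length bound separates the variable of a list from those of its proper suffixes, so
  argument variables are distinct even when sorts repeat.\<close>

lemma arg_vars_suffix: "v \<in> set (arg_vars N \<delta>s) \<Longrightarrow> \<exists>\<epsilon>s. v = arg_var N \<epsilon>s \<and> length \<epsilon>s \<le> length \<delta>s"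
  by (induction \<delta>s) force+

lemma distinct_arg_vars: "distinct (arg_vars N \<delta>s)"
  by (induction \<delta>s) (auto dest!: arg_vars_suffix)

lemma snd_arg_var [simp]: "snd (arg_var N \<delta>s) = lhd0 \<delta>s"
  by (simp add: arg_var_def)

lemma map_snd_arg_vars [simp]: "map snd (arg_vars N \<delta>s) = \<delta>s"
  by (induction \<delta>s) (auto simp: lhd0_def)

lemma length_arg_vars [simp]: "length (arg_vars N \<delta>s) = length \<delta>s"
  by (induction \<delta>s) auto

lemma nth_arg_vars: "j < length \<delta>s \<Longrightarrow> arg_vars N \<delta>s ! j = arg_var N (drop j \<delta>s)"
  by (induction \<delta>s arbitrary: j) (auto simp: nth_Cons split: nat.split)

lemma lhd0_drop: "j < length \<delta>s \<Longrightarrow> lhd0 (drop j \<delta>s) = \<delta>s ! j"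
  by (simp add: lhd0_def flip: Cons_nth_drop_Suc)

lemma trm_var_notin_arg_vars [simp]: "trm_var N t \<notin> set (arg_vars N \<delta>s)"
  by (auto dest: arg_vars_suffix)

lemma sort_of_has_sort: "has_sort \<Sigma> t \<delta> \<Longrightarrow> sort_of t = \<delta>"
  by (induction rule: has_sort.induct) (auto simp: lhd0_drop)

text \<open>The bound on variable indices gives freshness of the offset; it is not strict because
  \<open>Var\<close> has tag \<open>0\<close>. The strict bounds show that no term is its own
  argument and let recursion on codes descend.\<close>

lemma le_trm_code:
  "x \<le> trm_code (Var (x, \<delta>))"
  "t \<in> set ts \<Longrightarrow> trm_code t < trm_code (App C ts)"
  "trm_code t < trm_code (Sel C j t)"
proof -
  show "x \<le> trm_code (Var (x, \<delta>))"
    using le_prod_encode_1[of x \<delta>] le_prod_encode_2[of "prod_encode (x, \<delta>)" 0] by simp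
  have l: "n \<in> set ns \<Longrightarrow> n \<le> list_encode ns" for n ns
  proof (induction ns)
    case (Cons m ns)
    then show ?case
      using le_prod_encode_1[of m "list_encode ns"] le_prod_encode_2[of "list_encode ns" m] by auto
  qed simp
  show "trm_code t < trm_code (App C ts)" if "t \<in> set ts"
    using l[of "trm_code t" "map trm_code ts"] that
      le_pair(2)[of "list_encode (map trm_code ts)" "constructor_code C"]
      less_pair[of 2 "pair (constructor_code C) (list_encode (map trm_code ts))"]
    by (auto simp: pair_def)
  show "trm_code t < trm_code (Sel C j t)"
    using le_pair(2)[of "trm_code t" j] le_pair(2)[of "pair j (trm_code t)" "constructor_code C"]
      less_pair[of 3 "pair (constructor_code C) (pair j (trm_code t))"]
    by (auto simp: pair_def)
qed

text \<open>By \<open>le_trm_code\<close> every variable of \<open>t\<close> has an index at most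
  \<open>trm_code t\<close>, hence below \<open>N\<close>.\<close>

lemma eval_cong_below:
  "trm_code t < N \<Longrightarrow> (\<And>v. fst v < N \<Longrightarrow> \<nu>' v = \<nu> v) \<Longrightarrow> eval M \<nu>' t = eval M \<nu> t"
proof (induction t)
  case (Var v)
  then show ?case using le_trm_code(1)[of "fst v" "snd v"] by simp
next
  case (App C ts)
  have "eval M \<nu>' t = eval M \<nu> t" if "t \<in> set ts" for t
    using App.IH[OF that] App.prems le_trm_code(2)[OF that, of C] by simp
  then show ?case by (simp cong: map_cong)
next
  case (Sel C j t)
  then show ?case using le_trm_code(3)[of t C j] by simp
qed simp

section \<open>Well-sortedness of the result\<close>

locale codt_sig =
  fixes \<Sigma> :: signature
  assumes signature: "codt_signature \<Sigma>"
begin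

lemma constructor_sorts:
  assumes "C \<in> constructors \<Sigma>"
  shows "res_sort C \<in> sorts \<Sigma>" "set (arg_sorts C) \<subseteq> sorts \<Sigma>"
  using signature assms unfolding codt_signature_def sorts_def by blast+

lemma has_sort_sorts: "has_sort \<Sigma> t \<delta> \<Longrightarrow> \<delta> \<in> sorts \<Sigma>"
  by (erule has_sort.cases) (use constructor_sorts nth_mem in blast)+

lemma has_sort_Var: "has_sort \<Sigma> (Var v) \<delta> \<longleftrightarrow> \<delta> = snd v \<and> \<delta> \<in> sorts \<Sigma>"
  by (cases v) (auto intro: has_sort.Var elim: has_sort.cases)

lemma formula_sel_graph:
  assumes C: "C \<in> constructors \<Sigma>" and j: "j < length (arg_sorts C)"
    and z: "snd z = res_sort C" and v: "snd v = arg_sorts C ! j"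
  shows "formula \<Sigma> (sel_graph N C j z v)"
proof -
  let ?ys = "arg_vars N (arg_sorts C)"
  note sorts = constructor_sorts[OF C]
  have j': "arg_sorts C ! j \<in> sorts \<Sigma>" using sorts(2) j nth_mem by blast
  have "snd ` set ?ys = set (arg_sorts C)"
    using map_snd_arg_vars[of N "arg_sorts C"] by (metis list.set_map)
  then have ys: "snd ` set ?ys \<subseteq> sorts \<Sigma>" using sorts by simp
  have "snd (?ys ! i) = arg_sorts C ! i" if "i < length (arg_sorts C)" for i
    using that map_snd_arg_vars[of N "arg_sorts C"] by (metis length_arg_vars nth_map)
  then have "list_all2 (has_sort \<Sigma>) (map Var ?ys) (arg_sorts C)"
    using sorts(2) nth_mem by (force simp: list_all2_conv_all_nth has_sort_Var)
  then have "has_sort \<Sigma> (App C (map Var ?ys)) (res_sort C)" by (rule has_sort.App[OF C])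
  then have "\<exists>\<delta>. has_sort \<Sigma> (Var z) \<delta> \<and> has_sort \<Sigma> (App C (map Var ?ys)) \<delta>"
    using sorts z by (auto simp: has_sort_Var)
  then show ?thesis
    using ys j j' v has_sort.Dflt[OF C j]
    by (simp add: sel_graph_def Let_def has_sort_Var lhd0_drop)
qed

text \<open>A new variable carries \<open>sort_of\<close> of its term, which is the actual sort of a
  well-sorted term, so both sides of each defining equation have the same sort.\<close>

lemma formula_trm_graph: "has_sort \<Sigma> t \<delta> \<Longrightarrow> formula \<Sigma> (trm_graph N t)"
proof (induction rule: has_sort.induct)
  case (Var \<delta> x)
  then show ?case by (auto simp: has_sort_Var trm_var_def)
next
  case (App C ts)
  then have ts: "has_sort \<Sigma> t (sort_of t) \<and> formula \<Sigma> (trm_graph N t)" if "t \<in> set ts" for t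
    using that sort_of_has_sort by (fastforce simp: list_all2_conv_all_nth in_set_conv_nth)
  have ts': "sort_of t \<in> sorts \<Sigma>" if "t \<in> set ts" for t
    using ts[OF that] has_sort_sorts by blast
  have "list_all2 (has_sort \<Sigma>) (map (\<lambda>t. Var (trm_var N t)) ts) (arg_sorts C)"
    using App.IH sort_of_has_sort has_sort_sorts
    by (fastforce simp: list_all2_conv_all_nth has_sort_Var trm_var_def)
  from has_sort.App[OF App.hyps this] show ?case
    using constructor_sorts[OF App.hyps] ts ts'
    by (auto simp: list_all_iff comp_def has_sort_Var trm_var_def intro!: exI[of _ "res_sort C"])
next
  case (Sel C j t)
  then show ?case
    using formula_sel_graph[of C j "trm_var N t" "trm_var N (Sel C j t)" N]
      constructor_sorts[of C] sort_of_has_sort[OF Sel.hyps(3)]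
    by (simp add: trm_var_def lhd0_drop)
next
  case (Dflt C j)
  from has_sort.Dflt[OF this] show ?case
    using has_sort_sorts[OF has_sort.Dflt[OF Dflt]] Dflt(2)
    by (auto simp: has_sort_Var trm_var_def lhd0_drop)
qed

lemma formula_elim_sel: "formula \<Sigma> \<phi> \<Longrightarrow> formula \<Sigma> (elim_sel \<phi>)"
proof (induction \<phi>)
  case (Eq s t)
  then obtain \<delta> where "has_sort \<Sigma> s \<delta>" "has_sort \<Sigma> t \<delta>" by auto
  then show ?case
    using formula_trm_graph has_sort_sorts sort_of_has_sort
    by (auto simp: Let_def has_sort_Var trm_var_def)
qed auto

end

section \<open>Preservation of truth in structures with default values\<close>

locale codt_model = codt_sig +
  fixes M :: "ctree struct"
  assumes model: "codt_default_structure \<Sigma> M"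
begin

lemma model_structure: "codt_structure \<Sigma> M"
  using model by (simp add: codt_default_structure_def)

text \<open>The arguments of a constructor lie on the same side, data or codata, as its result.
  Well-sortedness and, for data, finiteness of a tree both reduce to its children.\<close>

lemma carr_res_sort_iff:
  assumes C: "C \<in> constructors \<Sigma>"
  shows "Node C ts \<in> carr M (res_sort C) \<longleftrightarrow> list_all2 (\<lambda>t \<delta>. t \<in> carr M \<delta>) ts (arg_sorts C)"
proof -
  have ct: "constructor_tree \<Sigma> (res_sort C) (Node C ts) \<longleftrightarrow> list_all2 (constructor_tree \<Sigma>) (arg_sorts C) ts"
    using C by (auto intro: constructor_tree.intros elim: constructor_tree.cases)
  have ft: "finite_tree (Node C ts) \<longleftrightarrow> (\<forall>t\<in>set ts. finite_tree t)"
    by (auto intro: finite_tree.intros elim: finite_tree.cases)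
  from C signature consider
      "res_sort C \<in> data_sorts \<Sigma>" "set (arg_sorts C) \<subseteq> data_sorts \<Sigma>"
    | "res_sort C \<in> codata_sorts \<Sigma>" "set (arg_sorts C) \<subseteq> codata_sorts \<Sigma>"
    unfolding codt_signature_def by blast
  then show ?thesis
  proof cases
    case 1
    then have "carr M (res_sort C) = {t. constructor_tree \<Sigma> (res_sort C) t \<and> finite_tree t}"
      "\<And>j. j < length (arg_sorts C) \<Longrightarrow>
        carr M (arg_sorts C ! j) = {t. constructor_tree \<Sigma> (arg_sorts C ! j) t \<and> finite_tree t}"
      using model_structure nth_mem unfolding codt_structure_def by blast+
    then show ?thesis by (auto simp: ct ft list_all2_conv_all_nth all_set_conv_all_nth)
  next
    case 2
    then have "carr M (res_sort C) = {t. constructor_tree \<Sigma> (res_sort C) t}"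
      "\<And>j. j < length (arg_sorts C) \<Longrightarrow>
        carr M (arg_sorts C ! j) = {t. constructor_tree \<Sigma> (arg_sorts C ! j) t}"
      using model_structure nth_mem unfolding codt_structure_def by blast+
    then show ?thesis by (auto simp: ct ft list_all2_conv_all_nth in_set_conv_nth)
  qed
qed

lemma con_int_Node:
  "C \<in> constructors \<Sigma> \<Longrightarrow> list_all2 (\<lambda>t \<delta>. t \<in> carr M \<delta>) ts (arg_sorts C) \<Longrightarrow> con_int M C ts = Node C ts"
  using model_structure unfolding codt_structure_def by blast

text \<open>The semantic content of the two disjuncts of \<open>sel_graph\<close>: a tree of the
  carrier has root \<open>C\<close> exactly if it is a value of \<open>C\<close>, so the test on the
  root becomes an existential statement.\<close>

lemma sel_int_iff:
  assumes C: "C \<in> constructors \<Sigma>" and j: "j < length (arg_sorts C)" and t: "t \<in> carr M (res_sort C)"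
  shows "a = sel_int M C j t \<longleftrightarrow>
    (\<exists>ts. list_all2 (\<lambda>t \<delta>. t \<in> carr M \<delta>) ts (arg_sorts C) \<and> t = con_int M C ts \<and> a = ts ! j) \<or>
    \<not> (\<exists>ts. list_all2 (\<lambda>t \<delta>. t \<in> carr M \<delta>) ts (arg_sorts C) \<and> t = con_int M C ts) \<and> a = dflt_int M C j"
proof (cases "root t = C")
  case True
  then have t': "t = Node C (children t)" by (cases t) auto
  with t C have l: "list_all2 (\<lambda>t \<delta>. t \<in> carr M \<delta>) (children t) (arg_sorts C)"
    using carr_res_sort_iff by metis
  then have tc: "t = con_int M C (children t)" using con_int_Node[OF C] t' by simp
  \<comment> \<open>By the selector law all preimages of \<open>t\<close> under \<open>C\<close>
    agree at position \<open>j\<close>, so the choice of \<open>ts\<close> does not matter.\<close>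
  have "sel_int M C j (con_int M C ts) = ts ! j"
    if "list_all2 (\<lambda>t \<delta>. t \<in> carr M \<delta>) ts (arg_sorts C)" for ts
    using that C j model unfolding codt_default_structure_def by blast
  then show ?thesis using l tc by metis
next
  case False
  then have "sel_int M C j t = dflt_int M C j"
    using C j t model unfolding codt_default_structure_def by blast
  moreover have "t \<noteq> con_int M C ts" if "list_all2 (\<lambda>t \<delta>. t \<in> carr M \<delta>) ts (arg_sorts C)" for ts
    using con_int_Node[OF C that] False by auto
  ultimately show ?thesis by auto
qed

lemma sel_int_carr:
  assumes "C \<in> constructors \<Sigma>" "j < length (arg_sorts C)" "t \<in> carr M (res_sort C)"
  shows "sel_int M C j t \<in> carr M (arg_sorts C ! j)"
proof -
  have "dflt_int M C j \<in> carr M (arg_sorts C ! j)"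
    using assms model unfolding codt_default_structure_def by blast
  then show ?thesis using sel_int_iff[OF assms, of "sel_int M C j t"] assms(2)
    by (auto simp: list_all2_conv_all_nth)
qed

lemma eval_carr:
  assumes "valuation \<Sigma> M \<nu>" shows "has_sort \<Sigma> t \<delta> \<Longrightarrow> eval M \<nu> t \<in> carr M \<delta>"
proof (induction rule: has_sort.induct)
  case (Var \<delta> x)
  then show ?case using assms by (simp add: valuation_def)
next
  case (App C ts)
  then have "list_all2 (\<lambda>t \<delta>. t \<in> carr M \<delta>) (map (eval M \<nu>) ts) (arg_sorts C)"
    by (auto simp: list_all2_conv_all_nth)
  then show ?case using App con_int_Node carr_res_sort_iff by simp
next
  case (Sel C j t)
  then show ?case using sel_int_carr by simp
next
  case (Dflt C j)
  then show ?case using model unfolding codt_default_structure_def by simp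
qed

text \<open>Trades a block of argument variables for a tuple of carrier elements. \<open>P\<close>
  is left abstract to serve both blocks of \<open>sel_graph\<close>.\<close>

lemma sat_Exs_arg_vars:
  assumes P: "\<And>\<nu>'. (\<And>v. v \<notin> set (arg_vars N \<delta>s) \<Longrightarrow> \<nu>' v = \<nu> v) \<Longrightarrow>
     sat M \<nu>' \<phi> \<longleftrightarrow> P (map \<nu>' (arg_vars N \<delta>s))"
  shows "sat M \<nu> (Exs (arg_vars N \<delta>s) \<phi>) \<longleftrightarrow>
    (\<exists>ts. list_all2 (\<lambda>t \<delta>. t \<in> carr M \<delta>) ts \<delta>s \<and> P ts)" (is "_ \<longleftrightarrow> ?R")
proof
  let ?vs = "arg_vars N \<delta>s"
  have snd_nth: "snd (?vs ! i) = \<delta>s ! i" if "i < length \<delta>s" for i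
    using that map_snd_arg_vars[of N \<delta>s] by (metis length_arg_vars nth_map)
  {
    assume "sat M \<nu> (Exs ?vs \<phi>)"
    then obtain \<nu>' where \<nu>': "\<forall>v. v \<notin> set ?vs \<longrightarrow> \<nu>' v = \<nu> v" "\<forall>v\<in>set ?vs. \<nu>' v \<in> carr M (snd v)"
      "sat M \<nu>' \<phi>" unfolding sat_Exs by blast
    then have "P (map \<nu>' ?vs)" using P by blast
    moreover have "list_all2 (\<lambda>t \<delta>. t \<in> carr M \<delta>) (map \<nu>' ?vs) \<delta>s"
      using \<nu>'(2) by (auto simp: list_all2_conv_all_nth simp flip: snd_nth)
    ultimately show ?R by blast
  next
    assume ?R
    then obtain ts where ts: "list_all2 (\<lambda>t \<delta>. t \<in> carr M \<delta>) ts \<delta>s" "P ts" by blast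
    \<comment> \<open>As the variables are distinct, the tuple can be read as a finite map on them;
      elsewhere the valuation is kept.\<close>
    define \<nu>' where "\<nu>' v = (case map_of (zip ?vs ts) v of Some a \<Rightarrow> a | None \<Rightarrow> \<nu> v)" for v
    have len: "length ts = length \<delta>s" using ts(1) by (rule list_all2_lengthD)
    have nth: "\<nu>' (?vs ! i) = ts ! i" if "i < length \<delta>s" for i
      using that len distinct_arg_vars by (simp add: \<nu>'_def map_of_zip_nth)
    have "\<nu>' v = \<nu> v" if "v \<notin> set ?vs" for v
      using that len by (simp add: \<nu>'_def map_of_zip_is_None[THEN iffD2])
    moreover have "map \<nu>' ?vs = ts"
      using nth len by (intro nth_equalityI) auto
    moreover have "\<nu>' v \<in> carr M (snd v)" if "v \<in> set ?vs" for v
      using that nth snd_nth ts(1) by (auto simp: in_set_conv_nth list_all2_conv_all_nth)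
    ultimately show "sat M \<nu> (Exs ?vs \<phi>)"
      unfolding sat_Exs using P ts(2) by (intro exI[of _ \<nu>']) auto
  }
qed

text \<open>The conditions \<open>fresh\<close> keep the argument variables from capturing
  \<open>z\<close> and \<open>v\<close>; then \<open>sel_int_iff\<close> matches the
  disjuncts.\<close>

lemma sat_sel_graph:
  assumes C: "C \<in> constructors \<Sigma>" and j: "j < length (arg_sorts C)"
    and z: "\<nu> z \<in> carr M (res_sort C)"
    and fresh: "z \<notin> set (arg_vars N (arg_sorts C))" "v \<notin> set (arg_vars N (arg_sorts C))"
  shows "sat M \<nu> (sel_graph N C j z v) \<longleftrightarrow> \<nu> v = sel_int M C j (\<nu> z)"
proof -
  let ?ys = "arg_vars N (arg_sorts C)"
  let ?e = "Eq (Var z) (App C (map Var ?ys))"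
  have 1: "sat M \<nu> (Exs ?ys ?e) \<longleftrightarrow>
      (\<exists>ts. list_all2 (\<lambda>t \<delta>. t \<in> carr M \<delta>) ts (arg_sorts C) \<and> \<nu> z = con_int M C ts)"
    by (rule sat_Exs_arg_vars) (use fresh in \<open>simp add: comp_def\<close>)
  have 2: "sat M \<nu> (Exs ?ys (And ?e (Eq (Var v) (Var (arg_var N (drop j (arg_sorts C))))))) \<longleftrightarrow>
      (\<exists>ts. list_all2 (\<lambda>t \<delta>. t \<in> carr M \<delta>) ts (arg_sorts C) \<and> \<nu> z = con_int M C ts \<and> \<nu> v = ts ! j)"
    by (rule sat_Exs_arg_vars) (use fresh j in \<open>simp add: comp_def nth_arg_vars\<close>)
  show ?thesis
    unfolding sel_int_iff[OF C j z] sel_graph_def Let_def sat.simps 1 2 by simp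
qed

text \<open>The valuation is arbitrary in the induction because quantifiers change it, but only at
  indices from \<open>N\<close> on, where no argument term looks.\<close>

lemma sat_trm_graph:
  assumes "has_sort \<Sigma> t \<delta>" "valuation \<Sigma> M \<nu>" "trm_code t < N"
  shows "sat M \<nu> (trm_graph N t) \<longleftrightarrow> \<nu> (trm_var N t) = eval M \<nu> t"
  using assms
proof (induction arbitrary: \<nu> rule: has_sort.induct)
  case (App C ts)
  let ?vs = "map (trm_var N) ts"
  have below: "trm_code t < N" if "t \<in> set ts" for t
    using le_trm_code(2)[OF that, of C] App.prems by simp
  have sorted: "has_sort \<Sigma> t (sort_of t)" if "t \<in> set ts" for t
  proof -
    from that obtain i where i: "i < length ts" "t = ts ! i" by (auto simp: in_set_conv_nth)
    show ?thesis using list_all2_nthD[OF App.IH i(1)] i(2) sort_of_has_sort by metis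
  qed
  have IH: "sat M \<nu>' (trm_graph N t) \<longleftrightarrow> \<nu>' (trm_var N t) = eval M \<nu>' t"
    if t: "t \<in> set ts" and \<nu>': "valuation \<Sigma> M \<nu>'" for t \<nu>'
  proof -
    from t obtain i where i: "i < length ts" "t = ts ! i" by (auto simp: in_set_conv_nth)
    show ?thesis using list_all2_nthD[OF App.IH i(1)] \<nu>' below[OF t] i(2) by blast
  qed
  have fresh: "trm_var N (App C ts) \<notin> set ?vs"
    using le_trm_code(2)[of "App C ts" ts C] by auto
  have agree: "eval M \<nu>' t = eval M \<nu> t"
    if "t \<in> set ts" "\<forall>v. v \<notin> set ?vs \<longrightarrow> \<nu>' v = \<nu> v" for t \<nu>'
  proof (rule eval_cong_below[OF below[OF that(1)]])
    show "\<nu>' v = \<nu> v" if "fst v < N" for v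
      using \<open>\<forall>v. v \<notin> set ?vs \<longrightarrow> \<nu>' v = \<nu> v\<close> that fst_trm_var[of N]
      by (metis (no_types, lifting) imageE leD list.set_map)
  qed
  show ?case
  proof
    assume "sat M \<nu> (trm_graph N (App C ts))"
    then obtain \<nu>' where \<nu>': "\<forall>v. v \<notin> set ?vs \<longrightarrow> \<nu>' v = \<nu> v" "\<forall>v\<in>set ?vs. \<nu>' v \<in> carr M (snd v)"
      and g: "\<forall>t\<in>set ts. sat M \<nu>' (trm_graph N t)"
      and e: "\<nu>' (trm_var N (App C ts)) = con_int M C (map (\<lambda>t. \<nu>' (trm_var N t)) ts)"
      by (auto simp: sat_Exs list_all_iff comp_def)
    have "valuation \<Sigma> M \<nu>'" by (rule valuation_cong[OF App.prems(1) \<nu>'])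
    then have "\<nu>' (trm_var N t) = eval M \<nu> t" if "t \<in> set ts" for t
      using g IH agree[OF _ \<nu>'(1)] that by simp
    then show "\<nu> (trm_var N (App C ts)) = eval M \<nu> (App C ts)"
      using e \<nu>'(1)[rule_format, OF fresh] by (simp cong: map_cong)
  next
    assume e: "\<nu> (trm_var N (App C ts)) = eval M \<nu> (App C ts)"
    \<comment> \<open>Each argument's variable receives the value of that argument. Injectivity of
      \<open>trm_var\<close> makes this well defined, also for repeated arguments.\<close>
    define \<nu>' where "\<nu>' v = (if v \<in> set ?vs then eval M \<nu> (inv (trm_var N) v) else \<nu> v)" for v
    have "inj (trm_var N)" by (rule injI) simp
    then have v: "\<nu>' (trm_var N t) = eval M \<nu> t" if "t \<in> set ts" for t
      using that by (simp add: \<nu>'_def)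
    have 1: "\<forall>v. v \<notin> set ?vs \<longrightarrow> \<nu>' v = \<nu> v" by (simp add: \<nu>'_def)
    have 2: "\<forall>v\<in>set ?vs. \<nu>' v \<in> carr M (snd v)"
      using v sorted eval_carr[OF App.prems(1)] by (auto simp: trm_var_def)
    have "valuation \<Sigma> M \<nu>'" by (rule valuation_cong[OF App.prems(1) 1 2])
    then have "\<forall>t\<in>set ts. sat M \<nu>' (trm_graph N t)"
      using IH agree[OF _ 1] v by simp
    moreover have "\<nu>' (trm_var N (App C ts)) = con_int M C (map (\<lambda>t. \<nu>' (trm_var N t)) ts)"
      using e 1[rule_format, OF fresh] v by (simp cong: map_cong)
    ultimately show "sat M \<nu> (trm_graph N (App C ts))"
      using 1 2 by (auto simp: sat_Exs list_all_iff comp_def intro!: exI[of _ \<nu>'])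
  qed
next
  case (Sel C j t)
  let ?z = "trm_var N t"
  have below: "trm_code t < N" using le_trm_code(3)[of t C j] Sel.prems by simp
  have s: "snd ?z = res_sort C" using sort_of_has_sort[OF Sel.hyps(3)] by (simp add: trm_var_def)
  have ne: "trm_var N (Sel C j t) \<noteq> ?z" using le_trm_code(3)[of t C j] by auto
  have ev: "eval M (\<nu>(?z := a)) t = eval M \<nu> t" for a
    by (rule eval_cong_below[OF below]) (use fst_trm_var[of N t] in auto)
  \<comment> \<open>The graph of \<open>t\<close> pins \<open>a\<close> down to the value of
    \<open>t\<close>, so the existential over \<open>a\<close> is a one-point quantifier.\<close>
  have g: "sat M (\<nu>(?z := a)) (trm_graph N t) \<longleftrightarrow> a = eval M \<nu> t" if "a \<in> carr M (res_sort C)" for a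
    using Sel.IH[OF valuation_upd[OF Sel.prems(1), of a ?z] below] that s ev by (simp add: fun_upd_def)
  have sg: "sat M (\<nu>(?z := a)) (sel_graph N C j ?z (trm_var N (Sel C j t))) \<longleftrightarrow>
      \<nu> (trm_var N (Sel C j t)) = sel_int M C j a" if "a \<in> carr M (res_sort C)" for a
    using sat_sel_graph[OF Sel.hyps(1,2), of "\<nu>(?z := a)" ?z N "trm_var N (Sel C j t)"] that ne
    by simp
  have "sat M \<nu> (trm_graph N (Sel C j t)) \<longleftrightarrow>
    (\<exists>a\<in>carr M (res_sort C). a = eval M \<nu> t \<and> \<nu> (trm_var N (Sel C j t)) = sel_int M C j a)"
    using g sg s by auto
  also have "\<dots> \<longleftrightarrow> \<nu> (trm_var N (Sel C j t)) = eval M \<nu> (Sel C j t)"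
    using eval_carr[OF Sel.prems(1) Sel.hyps(3)] by auto
  finally show ?case .
qed simp_all

lemma sat_elim_sel:
  "formula \<Sigma> \<phi> \<Longrightarrow> valuation \<Sigma> M \<nu> \<Longrightarrow> sat M \<nu> (elim_sel \<phi>) \<longleftrightarrow> sat M \<nu> \<phi>"
proof (induction \<phi> arbitrary: \<nu>)
  case (Eq s t)
  then obtain \<delta> where sort: "has_sort \<Sigma> s \<delta>" "has_sort \<Sigma> t \<delta>" by auto
  let ?N = "Suc (trm_code s + trm_code t)"
  let ?vs = "[trm_var ?N s, trm_var ?N t]"
  have so: "sort_of s = \<delta>" "sort_of t = \<delta>" using sort sort_of_has_sort by auto
  have ag: "eval M \<nu>' u = eval M \<nu> u"
    if "\<forall>v. v \<notin> set ?vs \<longrightarrow> \<nu>' v = \<nu> v" "trm_code u < ?N" for \<nu>' u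
  proof (rule eval_cong_below[OF that(2)])
    show "\<nu>' v = \<nu> v" if "fst v < ?N" for v
      using \<open>\<forall>v. v \<notin> set ?vs \<longrightarrow> \<nu>' v = \<nu> v\<close>[rule_format, of v] that
        fst_trm_var[of ?N s] fst_trm_var[of ?N t] by fastforce
  qed
  \<comment> \<open>Below the two new quantifiers the graphs fix the variables to values taken in
    the original valuation.\<close>
  have *: "sat M \<nu>' (trm_graph ?N s) \<longleftrightarrow> \<nu>' (trm_var ?N s) = eval M \<nu> s"
     "sat M \<nu>' (trm_graph ?N t) \<longleftrightarrow> \<nu>' (trm_var ?N t) = eval M \<nu> t"
    if h: "\<forall>v. v \<notin> set ?vs \<longrightarrow> \<nu>' v = \<nu> v" "\<forall>v\<in>set ?vs. \<nu>' v \<in> carr M (snd v)" for \<nu>'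
    using sat_trm_graph[OF sort(1) valuation_cong[OF Eq.prems(2) h], of ?N]
      sat_trm_graph[OF sort(2) valuation_cong[OF Eq.prems(2) h], of ?N] ag[OF h(1)]
    by simp_all
  have "sat M \<nu> (elim_sel (Eq s t)) \<longleftrightarrow> (\<exists>\<nu>'. (\<forall>v. v \<notin> set ?vs \<longrightarrow> \<nu>' v = \<nu> v) \<and>
     (\<forall>v\<in>set ?vs. \<nu>' v \<in> carr M (snd v)) \<and> \<nu>' (trm_var ?N s) = eval M \<nu> s \<and>
     \<nu>' (trm_var ?N t) = eval M \<nu> t \<and> \<nu>' (trm_var ?N s) = \<nu>' (trm_var ?N t))"
    unfolding elim_sel.simps Let_def sat_Exs sat.simps eval.simps using * by blast
  also have "\<dots> \<longleftrightarrow> eval M \<nu> s = eval M \<nu> t"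
  proof
    assume e: "eval M \<nu> s = eval M \<nu> t"
    have c: "eval M \<nu> s \<in> carr M \<delta>" "eval M \<nu> t \<in> carr M \<delta>"
      using sort eval_carr[OF Eq.prems(2)] by auto
    show "\<exists>\<nu>'. (\<forall>v. v \<notin> set ?vs \<longrightarrow> \<nu>' v = \<nu> v) \<and>
     (\<forall>v\<in>set ?vs. \<nu>' v \<in> carr M (snd v)) \<and> \<nu>' (trm_var ?N s) = eval M \<nu> s \<and>
     \<nu>' (trm_var ?N t) = eval M \<nu> t \<and> \<nu>' (trm_var ?N s) = \<nu>' (trm_var ?N t)"
      \<comment> \<open>If \<open>s\<close> and \<open>t\<close> are the same term, the second
        update hits the same variable, with the same value.\<close>
      by (rule exI[of _ "\<nu>(trm_var ?N s := eval M \<nu> s, trm_var ?N t := eval M \<nu> t)"])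
        (use e c so in \<open>auto simp: trm_var_def\<close>)
  qed auto
  finally show ?case by simp
next
  case (All v \<phi>)
  then show ?case by (simp add: valuation_upd)
next
  case (Ex v \<phi>)
  then show ?case by (simp add: valuation_upd)
qed auto

end


section \<open>Elimination of selectors on codes\<close>

text \<open>
  The prefix \<open>c\<close>, as in \<open>ctrm_graph\<close> for \<^const>\<open>trm_graph\<close>, marks the counterpart on codes of a
  syntactic operation; the first components of pairs are the tags of \<^const>\<open>trm_code\<close> and
  \<^const>\<open>fm_code\<close>.
\<close>

definition csort :: "nat \<Rightarrow> nat" where
  "csort t = (if pfst t = 0 then psnd (psnd t)
    else if pfst t = 1 then lhd (ldrop (psnd (psnd t)) (pfst (psnd (pfst (psnd t)))))
    else if pfst t = 2 then psnd (psnd (pfst (psnd t)))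
    else lhd (ldrop (pfst (psnd (psnd t))) (pfst (psnd (pfst (psnd t))))))"

definition ctrm_var :: "nat \<Rightarrow> nat \<Rightarrow> nat" where
  "ctrm_var N t = pair (N + (t + t)) (csort t)"

definition carg_var :: "nat \<Rightarrow> nat \<Rightarrow> nat" where
  "carg_var N l = pair (Suc (N + (l + l))) (lhd l)"

definition carg_vars :: "nat \<Rightarrow> nat \<Rightarrow> nat" where
  "carg_vars N l = lrec 0 (\<lambda>l r. lcons (carg_var N l) r) l"

definition cVars :: "nat \<Rightarrow> nat" where
  "cVars l = lrec 0 (\<lambda>l r. lcons (pair 0 (lhd l)) r) l"

definition ctrm_vars :: "nat \<Rightarrow> nat \<Rightarrow> nat" where
  "ctrm_vars N l = lrec 0 (\<lambda>l r. lcons (ctrm_var N (lhd l)) r) l"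

definition cExs :: "nat \<Rightarrow> nat \<Rightarrow> nat" where
  "cExs vs p = lrec p (\<lambda>l r. pair 9 (pair (lhd l) r)) vs"

definition cApp :: "nat \<Rightarrow> nat \<Rightarrow> nat" where
  "cApp C vs = pair 2 (pair C (cVars vs))"

definition cEq :: "nat \<Rightarrow> nat \<Rightarrow> nat" where
  "cEq s t = pair 2 (pair s t)"

definition cAnd :: "nat \<Rightarrow> nat \<Rightarrow> nat" where
  "cAnd p q = pair 4 (pair p q)"

definition csel_graph :: "nat \<Rightarrow> nat \<Rightarrow> nat \<Rightarrow> nat \<Rightarrow> nat \<Rightarrow> nat" where
  "csel_graph N C j z v = pair 5 (pair
     (cExs (carg_vars N (pfst (psnd C)))
       (cAnd (cEq (pair 0 z) (cApp C (carg_vars N (pfst (psnd C)))))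
         (cEq (pair 0 v) (pair 0 (carg_var N (ldrop j (pfst (psnd C))))))))
     (cAnd (pair 3 (cExs (carg_vars N (pfst (psnd C)))
         (cEq (pair 0 z) (cApp C (carg_vars N (pfst (psnd C)))))))
       (cEq (pair 0 v) (pair 1 (pair C j)))))"

text \<open>\<open>look h t\<close> reads off results for the codes of arguments. The last branch
  serves \<open>Var\<close> and \<open>Dflt\<close> alike, since both graphs equate the new variable
  with the term itself.\<close>

definition ctrm_graph_step :: "nat \<Rightarrow> nat \<Rightarrow> nat \<Rightarrow> nat" where
  "ctrm_graph_step N t h =
    (if pfst t = 2 then
       cExs (ctrm_vars N (psnd (psnd t)))
         (cAnd (lrec (pair 0 0) (\<lambda>l r. cAnd (look h t (lhd l)) r) (psnd (psnd t)))
           (cEq (pair 0 (ctrm_var N t))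
             (cApp (pfst (psnd t)) (ctrm_vars N (psnd (psnd t))))))
     else if pfst t = 3 then
       pair 9 (pair (ctrm_var N (psnd (psnd (psnd t))))
         (cAnd (look h t (psnd (psnd (psnd t))))
           (csel_graph N (pfst (psnd t)) (pfst (psnd (psnd t)))
             (ctrm_var N (psnd (psnd (psnd t)))) (ctrm_var N t))))
     else cEq (pair 0 (ctrm_var N t)) t)"

definition ctrm_graph :: "nat \<Rightarrow> nat \<Rightarrow> nat" where
  "ctrm_graph N t = cov (ctrm_graph_step N) t"

definition celim_Eq :: "nat \<Rightarrow> nat \<Rightarrow> nat \<Rightarrow> nat" where
  "celim_Eq N s t = pair 9 (pair (ctrm_var N s) (pair 9 (pair (ctrm_var N t)
     (cAnd (ctrm_graph N s) (cAnd (ctrm_graph N t)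
       (cEq (pair 0 (ctrm_var N s)) (pair 0 (ctrm_var N t))))))))"

text \<open>The last branch treats the binary connectives, tags \<open>4\<close> to
  \<open>7\<close>, uniformly by copying the tag.\<close>

definition celim_step :: "nat \<Rightarrow> nat \<Rightarrow> nat" where
  "celim_step p h =
    (if pfst p = 0 then p
     else if pfst p = 1 then p
     else if pfst p = 2 then
       celim_Eq (Suc (pfst (psnd p) + psnd (psnd p))) (pfst (psnd p)) (psnd (psnd p))
     else if pfst p = 3 then pair 3 (look h p (psnd p))
     else if pfst p = 8 then pair 8 (pair (pfst (psnd p)) (look h p (psnd (psnd p))))
     else if pfst p = 9 then pair 9 (pair (pfst (psnd p)) (look h p (psnd (psnd p))))
     else pair (pfst p) (pair (look h p (pfst (psnd p))) (look h p (psnd (psnd p)))))"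

definition celim :: "nat \<Rightarrow> nat" where
  "celim p = cov celim_step p"

section \<open>Recursiveness of the operations on codes\<close>

lemmas rec1_list_intros = rec1_intros rec1_if rec1_lhd rec1_ldrop rec1_lcons rec1_look rec1_lrec

lemma rec1_ctrm_var: "rec1 f \<Longrightarrow> rec1 g \<Longrightarrow> rec1 (\<lambda>x. ctrm_var (f x) (g x))"
  unfolding ctrm_var_def csort_def by (intro rec1_list_intros)

lemma rec1_carg_var: "rec1 f \<Longrightarrow> rec1 g \<Longrightarrow> rec1 (\<lambda>x. carg_var (f x) (g x))"
  unfolding carg_var_def by (intro rec1_list_intros)

lemma rec1_carg_vars: "rec1 f \<Longrightarrow> rec1 g \<Longrightarrow> rec1 (\<lambda>x. carg_vars (f x) (g x))"
  \<comment> \<open>Inside the fold the offset \<open>f x\<close> reappears as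
    \<open>f (pfst q)\<close>, hence the instance that composes \<open>f\<close> with the first
    projection.\<close>
  unfolding carg_vars_def by (intro rec1_list_intros rec1_carg_var rec1_comp1[of f pfst, OF _ rec1_pfst])

lemma rec1_ctrm_vars: "rec1 f \<Longrightarrow> rec1 g \<Longrightarrow> rec1 (\<lambda>x. ctrm_vars (f x) (g x))"
  unfolding ctrm_vars_def by (intro rec1_list_intros rec1_ctrm_var rec1_comp1[of f pfst, OF _ rec1_pfst])

lemma rec1_cExs: "rec1 f \<Longrightarrow> rec1 g \<Longrightarrow> rec1 (\<lambda>x. cExs (f x) (g x))"
  unfolding cExs_def by (intro rec1_list_intros)

lemma rec1_cApp: "rec1 f \<Longrightarrow> rec1 g \<Longrightarrow> rec1 (\<lambda>x. cApp (f x) (g x))"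
  unfolding cApp_def cVars_def by (intro rec1_list_intros)

lemma rec1_cEq: "rec1 f \<Longrightarrow> rec1 g \<Longrightarrow> rec1 (\<lambda>x. cEq (f x) (g x))"
  unfolding cEq_def by (intro rec1_list_intros)

lemma rec1_cAnd: "rec1 f \<Longrightarrow> rec1 g \<Longrightarrow> rec1 (\<lambda>x. cAnd (f x) (g x))"
  unfolding cAnd_def by (intro rec1_list_intros)

lemmas rec1_code_intros = rec1_list_intros rec1_ctrm_var rec1_carg_var rec1_carg_vars
  rec1_ctrm_vars rec1_cExs rec1_cApp rec1_cEq rec1_cAnd

lemma rec1_csel_graph:
  "rec1 f \<Longrightarrow> rec1 g \<Longrightarrow> rec1 h \<Longrightarrow> rec1 k \<Longrightarrow> rec1 l \<Longrightarrow>
    rec1 (\<lambda>x. csel_graph (f x) (g x) (h x) (k x) (l x))"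
  unfolding csel_graph_def by (intro rec1_code_intros)

lemma rec1_ctrm_graph:
  "rec1 f \<Longrightarrow> rec1 g \<Longrightarrow> rec1 (\<lambda>x. ctrm_graph (f x) (g x))"
  unfolding ctrm_graph_def ctrm_graph_step_def
  by (intro rec1_cov rec1_code_intros rec1_csel_graph rec1_comp1[of f pfst, OF _ rec1_pfst])

lemma rec1_celim: "rec1 celim"
  unfolding celim_def[abs_def] celim_step_def celim_Eq_def
  by (intro rec1_cov rec1_code_intros rec1_ctrm_graph)

section \<open>Agreement of the operations on codes with the syntax\<close>

lemma prod_encode_pair: "prod_encode (a, b) = pair a b"
  by (simp add: pair_def)

lemma prod_encode_var: "prod_encode v = pair (fst v) (snd v)"
  by (simp add: pair_def)

lemma lhd_list_encode: "lhd (list_encode xs) = lhd0 xs"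
  by (cases xs) (auto simp: lhd_def lhd0_def prod_encode_pair)

lemma lcons_list_encode: "lcons x (list_encode xs) = list_encode (x # xs)"
  by (simp add: lcons_def pair_def)

lemma constructor_code_eq:
  "constructor_code C = pair (cname C) (pair (list_encode (arg_sorts C)) (res_sort C))"
  by (cases C) (simp add: pair_def)

lemma lrec_map:
  "lrec 0 (\<lambda>l r. lcons (f (lhd l)) r) (list_encode xs) = list_encode (map f xs)"
  by (induction xs) (simp_all add: lhd_list_encode lhd0_def lcons_list_encode del: list_encode.simps(2))

lemma csort_trm_code: "csort (trm_code t) = sort_of t"
  by (cases t) (simp_all add: csort_def prod_encode_pair prod_encode_var constructor_code_eq
      ldrop_list_encode lhd_list_encode)

lemma ctrm_var_trm_code: "ctrm_var N (trm_code t) = prod_encode (trm_var N t)"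
  by (simp add: ctrm_var_def trm_var_def csort_trm_code pair_def)

lemma carg_var_list_encode: "carg_var N (list_encode \<delta>s) = prod_encode (arg_var N \<delta>s)"
  by (simp add: carg_var_def arg_var_def lhd_list_encode pair_def)

lemma carg_vars_list_encode:
  "carg_vars N (list_encode \<delta>s) = list_encode (map prod_encode (arg_vars N \<delta>s))"
  unfolding carg_vars_def
  by (induction \<delta>s) (simp_all add: carg_var_list_encode lcons_list_encode del: list_encode.simps(2))

lemma ctrm_vars_list_encode:
  "ctrm_vars N (list_encode (map trm_code ts)) = list_encode (map prod_encode (map (trm_var N) ts))"
  unfolding ctrm_vars_def lrec_map by (simp add: ctrm_var_trm_code comp_def)

lemma cApp_code:
  "cApp (constructor_code C) (list_encode (map prod_encode vs)) = trm_code (App C (map Var vs))"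
  unfolding cApp_def cVars_def lrec_map by (simp add: pair_def comp_def)

lemma cExs_code:
  "cExs (list_encode (map prod_encode vs)) (fm_code \<phi>) = fm_code (Exs vs \<phi>)"
  unfolding cExs_def Exs_def
  by (induction vs) (simp_all add: lhd_list_encode lhd0_def prod_encode_pair del: list_encode.simps(2))

lemma cEq_code: "cEq (trm_code s) (trm_code t) = fm_code (Eq s t)"
  by (simp add: cEq_def pair_def)

lemma cAnd_code: "cAnd (fm_code \<phi>) (fm_code \<psi>) = fm_code (And \<phi> \<psi>)"
  by (simp add: cAnd_def pair_def)

lemma Var_code: "pair 0 (prod_encode v) = trm_code (Var v)"
  by (simp add: pair_def)

lemma Dflt_code: "pair (Suc 0) (pair (constructor_code C) j) = trm_code (Dflt C j)"
  by (simp add: pair_def)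

lemma Neg_code: "pair 3 (fm_code \<phi>) = fm_code (Neg \<phi>)"
  by (simp add: pair_def)

lemma Or_code: "pair 5 (pair (fm_code \<phi>) (fm_code \<psi>)) = fm_code (Or \<phi> \<psi>)"
  by (simp add: pair_def)

lemma Ex_code: "pair 9 (pair (prod_encode v) (fm_code \<phi>)) = fm_code (Ex v \<phi>)"
  by (simp add: pair_def)

lemma Tru_code: "pair 0 0 = fm_code Tru"
  by (simp add: pair_def)

text \<open>Oriented from arithmetic to syntax, against the equations of \<open>trm_code\<close> and
  \<open>fm_code\<close>, which are therefore disabled where these rules rewrite.\<close>

lemmas code_folds = ctrm_var_trm_code carg_var_list_encode carg_vars_list_encode
  ctrm_vars_list_encode cApp_code cExs_code cEq_code cAnd_code Var_code Dflt_code Neg_code Or_code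
  Ex_code Tru_code

lemma csel_graph_code:
  "csel_graph N (constructor_code C) j (prod_encode z) (prod_encode v) = fm_code (sel_graph N C j z v)"
proof -
  have "pfst (psnd (constructor_code C)) = list_encode (arg_sorts C)"
    by (simp add: constructor_code_eq)
  then show ?thesis
    by (simp add: csel_graph_def sel_graph_def Let_def ldrop_list_encode code_folds
        del: trm_code.simps fm_code.simps)
qed

text \<open>Arguments have smaller codes than the term, so by \<open>look_hist\<close> the history
  entries consulted are the final values, known by induction.\<close>

lemma ctrm_graph_code: "ctrm_graph N (trm_code t) = fm_code (trm_graph N t)"
proof (induction t)
  case (Var v)
  have "pfst (trm_code (Var v)) = 0" by (simp add: prod_encode_pair)
  then show ?case
    by (simp add: ctrm_graph_def cov_def ctrm_graph_step_def code_folds del: trm_code.simps fm_code.simps)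
next
  case (Dflt C j)
  have "pfst (trm_code (Dflt C j)) = 1" by (simp add: prod_encode_pair)
  then show ?case
    by (simp add: ctrm_graph_def cov_def ctrm_graph_step_def code_folds del: trm_code.simps fm_code.simps)
next
  case (App C ts)
  let ?t = "App C ts" let ?h = "hist (ctrm_graph_step N) (trm_code (App C ts))"
  have t: "pfst (trm_code ?t) = 2" "pfst (psnd (trm_code ?t)) = constructor_code C"
    "psnd (psnd (trm_code ?t)) = list_encode (map trm_code ts)"
    by (simp_all add: prod_encode_pair)
  have look: "look ?h (trm_code ?t) (trm_code u) = fm_code (trm_graph N u)" if "u \<in> set ts" for u
    using App[OF that] look_hist[OF le_trm_code(2)[OF that, of C], of "ctrm_graph_step N"]
    by (simp add: ctrm_graph_def)
  \<comment> \<open>Generalised to lists \<open>us\<close> of arguments: the fold runs through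
    suffixes while the history remains that of the whole term.\<close>
  have "lrec (fm_code Tru) (\<lambda>l r. cAnd (look ?h (trm_code ?t) (lhd l)) r) (list_encode (map trm_code us))
      = fm_code (Conj (map (trm_graph N) us))" if "set us \<subseteq> set ts" for us
    using that by (induction us) (simp_all add: Conj_def lhd_list_encode lhd0_def look cAnd_code
        del: list_encode.simps(2) trm_code.simps fm_code.simps)
  then show ?case
    by (simp add: ctrm_graph_def cov_def ctrm_graph_step_def t code_folds
        del: trm_code.simps fm_code.simps map_map)
next
  case (Sel C j u)
  let ?t = "Sel C j u" let ?h = "hist (ctrm_graph_step N) (trm_code (Sel C j u))"
  have t: "pfst (trm_code ?t) = 3" "pfst (psnd (trm_code ?t)) = constructor_code C"
    "pfst (psnd (psnd (trm_code ?t))) = j" "psnd (psnd (psnd (trm_code ?t))) = trm_code u"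
    by (simp_all add: prod_encode_pair)
  have look: "look ?h (trm_code ?t) (trm_code u) = fm_code (trm_graph N u)"
    using Sel look_hist[OF le_trm_code(3)[of u C j], of "ctrm_graph_step N"]
    by (simp add: ctrm_graph_def)
  then show ?case
    by (simp add: ctrm_graph_def cov_def ctrm_graph_step_def t code_folds csel_graph_code
        del: trm_code.simps fm_code.simps)
qed

lemma celim_code: "celim (fm_code \<phi>) = fm_code (elim_sel \<phi>)"
proof -
  have look: "look (hist celim_step p) p q = celim q" if "q < p" for p q
    using look_hist[OF that, of celim_step] by (simp add: celim_def)
  \<comment> \<open>Formulas with subformulas have positive tags, so both components of the payload
    are smaller than the code.\<close>
  have less2: "b < pair a (pair c b)" "c < pair a (pair c b)" if "0 < a" for a b c
    using less_pair[OF that, of "pair c b"] le_pair[where a = c and b = b] by auto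
  show ?thesis
  proof (induction \<phi>)
    case (Eq s t)
    show ?case
      by (simp add: celim_def cov_def celim_step_def prod_encode_pair celim_Eq_def
          ctrm_graph_code ctrm_var_trm_code Exs_def Let_def cAnd_def cEq_def)
  \<comment> \<open>Restricting the unfolding of \<open>celim\<close> to visible pairs leaves the
    recursive calls on \<open>fm_code\<close> folded for the induction hypotheses.\<close>
  qed (simp_all add: celim_def[of "pair _ _"] cov_def celim_step_def prod_encode_pair prod_encode_var
      look less_pair less2)
qed

lemma effective_elim_sel: "effective elim_sel"
proof -
  obtain r where "\<forall>xs. length xs = 1 \<longrightarrow> computes r xs (celim (xs ! 0))"
    using rec1_celim unfolding rec1_def recn_def by blast
  then have "computes r [fm_code \<phi>] (fm_code (elim_sel \<phi>))" for \<phi>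
    by (metis One_nat_def celim_code length_Cons list.size(3) nth_Cons_0)
  then show ?thesis unfolding effective_def by blast
qed

theorem theorem2:
  shows "\<exists>F. effective F \<and>
    (\<forall>\<Sigma> \<phi>. codt_signature \<Sigma> \<longrightarrow> formula \<Sigma> \<phi> \<longrightarrow>
       formula \<Sigma> (F \<phi>) \<and> selector_free (F \<phi>) \<and> equivalent \<Sigma> \<phi> (F \<phi>))"
proof (intro exI[of _ elim_sel] conjI allI impI effective_elim_sel selector_free_elim_sel)
  fix \<Sigma> \<phi> assume \<Sigma>: "codt_signature \<Sigma>" and \<phi>: "formula \<Sigma> \<phi>"
  interpret codt_sig \<Sigma> by unfold_locales (rule \<Sigma>)
  show "formula \<Sigma> (elim_sel \<phi>)" by (rule formula_elim_sel[OF \<phi>])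
  show "equivalent \<Sigma> \<phi> (elim_sel \<phi>)"
    unfolding equivalent_def
  proof (intro allI impI)
    fix M \<nu> assume M: "codt_default_structure \<Sigma> M" and \<nu>: "valuation \<Sigma> M \<nu>"
    interpret codt_model \<Sigma> M by unfold_locales (rule M)
    show "sat M \<nu> \<phi> \<longleftrightarrow> sat M \<nu> (elim_sel \<phi>)" using sat_elim_sel[OF \<phi> \<nu>] by simp
  qed
qed

end
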